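(* (Relation for $\Gamma^1_{n,m}$.) Let $\mathcal L$ be a positive definite linear functional on $\prod^{N,M}$. For $0<n\le N$, $0<m\le M$, $$\Gamma^1_{n,m}\Gamma_{n,m}^\dagger=I_{n,m-1}\hat{\tilde E}_{n,m}(I^1_{n,m-1})^T+\Gamma_{n,m-1}^\dagger\Gamma^1_{n,m-1}+\mathcal K^1_{n,m}\,\overline{\tilde A_{n-1,m}}^{\,-1}\,\hat{\tilde E}_{n-1,m}^\dagger\tilde A_{n-1,m}\mathcal K_{n,m}^\dagger.$$
   Context: $\prod^{N,M}=\mathrm{span}\{z^iw^j:|i|\le N,|j|\le M\}$, $\hat\prod^{N,M}=\mathrm{span}\{z^iw^j:0\le i\le N,0\le j\le M\}$. For a (matrix valued) Laurent polynomial $Q$, $Q^\dagger(z,w)=Q(1/\bar z,1/\bar w)^\dagger$. A linear functional $\mathcal L$ on $\prod^{N,M}$ with $\mathcal L(z^{-i}w^{-j})=\overline{\mathcal L(z^iw^j)}$ is positive definite if $\mathcal L(pp^\dagger)>0$ for all nonzero $p\in\hat\prod^{N,M}$. It is applied entrywise and, for column vectors, $\langle X,Y\rangle=\mathcal L(XY^\dagger)$. Bars on matrices are entrywise conjugates. For $0\le l\le m$, $\phi^l_{n,m}$ is the unique element of $\mathrm{span}(\{z^iw^j:0\le i<n,0\le j\le m\}\cup\{z^nw^j:0\le j\le l\})$ with positive coefficient of $z^nw^l$, $\langle\phi^l_{n,m},\phi^l_{n,m}\rangle=1$, orthogonal to all of these monomials except $z^nw^l$; $\Phi_{n,m}=[\phi^m_{n,m},\dots,\phi^0_{n,m}]^T$.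 For $0\le l\le n$, $\tilde\phi^l_{n,m}$ is the unique element of $\mathrm{span}(\{z^iw^j:0\le i\le n,0\le j<m\}\cup\{z^iw^m:0\le i\le l\})$ with positive coefficient of $z^lw^m$, norm one, orthogonal to all of these monomials except $z^lw^m$; $\tilde\Phi_{n,m}=[\tilde\phi^n_{n,m},\dots,\tilde\phi^0_{n,m}]^T$. Reversals are the row vectors $\overleftarrow\Phi_{n,m}(z,w)=z^nw^m\Phi_{n,m}(1/\bar z,1/\bar w)^\dagger$, $\overleftarrow{\tilde\Phi}_{n,m}(z,w)=z^nw^m\tilde\Phi_{n,m}(1/\bar z,1/\bar w)^\dagger$. $\Phi_{n,-1}$ is empty; matrices with zero rows or columns are empty, and products over an empty index are zero. Coefficients: $\hat{\tilde E}_{n,m}=\langle w\tilde\Phi_{n,m-1},\overleftarrow{\tilde\Phi}_{n,m-1}^T\rangle$, $\tilde A_{n,m}=\langle w\tilde\Phi_{n,m-1},\tilde\Phi_{n,m}\rangle$ ($m\ge1$; $\tilde A_{n,m}$ is invertible), $\mathcal K_{n,m}=\langle\Phi_{n,m-1},\tilde\Phi_{n-1,m}\rangle$, $\mathcal K^1_{n,m}=\langle w\Phi_{n,m-1},\overleftarrow{\tilde\Phi}_{n-1,m}^T\rangle$, $\Gamma_{n,m}=\langle\Phi_{n,m-1},\Phi_{n,m}\rangle$, $\Gamma^1_{n,m}=\langle w\Phi_{n,m-1},\Phi_{n,m}\rangle$, $I_{n,m}=\langle\Phi_{n,m},\tilde\Phi_{n,m}\rangle$, $I^1_{n,m}=\langle\overleftarrow\Phi_{n,m}^T,\tilde\Phi_{n,m}\rangle$.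 *)

theory Defs
  imports
    "HOL-Library.Poly_Mapping"
    "HOL-Library.Product_Plus"
    "Jordan_Normal_Form.Gauss_Jordan_Elimination"
    "Jordan_Normal_Form.Schur_Decomposition"
begin

section \<open>Laurent polynomials in two variables\<close>

text \<open>A bivariate complex Laurent polynomial is its finitely supported family of coefficients:
  the coefficient of \<open>z\<^sup>i w\<^sup>j\<close> is stored at \<open>(i, j)\<close>. The product of \<^theory>\<open>HOL-Library.Poly_Mapping\<close>
  is the convolution product.\<close>

type_synonym laurent = "(int \<times> int) \<Rightarrow>\<^sub>0 complex"

definition lmono :: "int \<Rightarrow> int \<Rightarrow> laurent" where
  "lmono i j = Poly_Mapping.single (i, j) 1"

definition lscale :: "complex \<Rightarrow> laurent \<Rightarrow> laurent" where
  "lscale c p = Poly_Mapping.single 0 c * p"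

global_interpretation laurent: vector_space lscale
  by unfold_locales
    (simp_all add: lscale_def distrib_left distrib_right single_add mult.assoc [symmetric]
      mult_single)

definition lspan :: "(int \<times> int) set \<Rightarrow> laurent set" where
  "lspan S = laurent.span ((\<lambda>(i, j). lmono i j) ` S)"

definition laurent_space :: "int \<Rightarrow> int \<Rightarrow> laurent set" where
  "laurent_space N M = lspan {(i, j). \<bar>i\<bar> \<le> N \<and> \<bar>j\<bar> \<le> M}"

definition poly_space :: "int \<Rightarrow> int \<Rightarrow> laurent set" where
  "poly_space N M = lspan {(i, j). 0 \<le> i \<and> i \<le> N \<and> 0 \<le> j \<and> j \<le> M}"

text \<open>\<open>p\<^sup>\<dagger>(z, w)\<close> is the conjugate of \<open>p(1 / cnj z, 1 / cnj w)\<close>; thus a term with coefficient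
  \<open>c\<close> at \<open>(i, j)\<close> becomes one with coefficient \<open>cnj c\<close> at \<open>(-i, -j)\<close>.\<close>

definition ldagger :: "laurent \<Rightarrow> laurent" where
  "ldagger p = Poly_Mapping.map cnj (Poly_Mapping.map_key uminus p)"

lemma lookup_ldagger:
  "Poly_Mapping.lookup (ldagger p) (i, j) = cnj (Poly_Mapping.lookup p (- i, - j))"
proof -
  have "inj (uminus :: int \<times> int \<Rightarrow> int \<times> int)"
    by (simp add: inj_on_def)
  then show ?thesis
    by (simp add: ldagger_def Poly_Mapping.map.rep_eq map_key.rep_eq when_def)
qed

definition mdagger :: "laurent mat \<Rightarrow> laurent mat" where
  "mdagger Q = transpose_mat (map_mat ldagger Q)"


section \<open>Positive definite functionals\<close>

text \<open>A functional on \<open>laurent_space N M\<close> is represented by a function on all Laurent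
  polynomials whose values outside that space are irrelevant. On complex numbers, \<open>0 < x\<close> says
  that \<open>x\<close> is real and positive.\<close>

definition linear_functional_on :: "laurent set \<Rightarrow> (laurent \<Rightarrow> complex) \<Rightarrow> bool" where
  "linear_functional_on V L \<longleftrightarrow>
     (\<forall>p\<in>V. \<forall>q\<in>V. L (p + q) = L p + L q) \<and> (\<forall>c. \<forall>p\<in>V. L (lscale c p) = c * L p)"

definition hermitian_functional :: "int \<Rightarrow> int \<Rightarrow> (laurent \<Rightarrow> complex) \<Rightarrow> bool" where
  "hermitian_functional N M L \<longleftrightarrow>
     (\<forall>i j. \<bar>i\<bar> \<le> N \<longrightarrow> \<bar>j\<bar> \<le> M \<longrightarrow> L (lmono (- i) (- j)) = cnj (L (lmono i j)))"

definition positive_definite_functional :: "int \<Rightarrow> int \<Rightarrow> (laurent \<Rightarrow> complex) \<Rightarrow> bool" where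
  "positive_definite_functional N M L \<longleftrightarrow>
     linear_functional_on (laurent_space N M) L \<and> hermitian_functional N M L \<and>
     (\<forall>p\<in>poly_space N M. p \<noteq> 0 \<longrightarrow> 0 < L (p * ldagger p))"

text \<open>Column vectors of Laurent polynomials are one-column matrices.\<close>

definition vip :: "(laurent \<Rightarrow> complex) \<Rightarrow> laurent mat \<Rightarrow> laurent mat \<Rightarrow> complex mat" where
  "vip L X Y = map_mat L (X * mdagger Y)"


section \<open>Orthonormal polynomials\<close>

text \<open>The normalized element of \<open>lspan S\<close> with positive coefficient at \<open>k\<close> that is orthogonal to
  all monomials of \<open>S\<close> except the one at \<open>k\<close>; existence and uniqueness follow from positive
  definiteness when \<open>S\<close> lies in the index range of \<open>poly_space N M\<close> and \<open>k \<in> S\<close>.\<close>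

definition orthopoly ::
  "(laurent \<Rightarrow> complex) \<Rightarrow> (int \<times> int) set \<Rightarrow> int \<times> int \<Rightarrow> laurent" where
  "orthopoly L S k = (THE p. p \<in> lspan S \<and> 0 < Poly_Mapping.lookup p k \<and>
     L (p * ldagger p) = 1 \<and>
     (\<forall>(i, j)\<in>S - {k}. L (p * ldagger (lmono i j)) = 0))"

definition phi :: "(laurent \<Rightarrow> complex) \<Rightarrow> int \<Rightarrow> int \<Rightarrow> int \<Rightarrow> laurent" where
  "phi L n m l = orthopoly L
     ({(i, j). 0 \<le> i \<and> i < n \<and> 0 \<le> j \<and> j \<le> m} \<union> {(n, j) | j. 0 \<le> j \<and> j \<le> l}) (n, l)"

definition tphi :: "(laurent \<Rightarrow> complex) \<Rightarrow> int \<Rightarrow> int \<Rightarrow> int \<Rightarrow> laurent" where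
  "tphi L n m l = orthopoly L
     ({(i, j). 0 \<le> i \<and> i \<le> n \<and> 0 \<le> j \<and> j < m} \<union> {(i, m) | i. 0 \<le> i \<and> i \<le> l}) (l, m)"

text \<open>The integer indices allow \<open>m = -1\<close> below, where \<open>Phi L n m\<close> has no rows.\<close>

definition Phi :: "(laurent \<Rightarrow> complex) \<Rightarrow> int \<Rightarrow> int \<Rightarrow> laurent mat" where
  "Phi L n m = mat (nat (m + 1)) 1 (\<lambda>(r, _). phi L n m (m - int r))"

definition tPhi :: "(laurent \<Rightarrow> complex) \<Rightarrow> int \<Rightarrow> int \<Rightarrow> laurent mat" where
  "tPhi L n m = mat (nat (n + 1)) 1 (\<lambda>(r, _). tphi L n m (n - int r))"

definition rev_Phi :: "(laurent \<Rightarrow> complex) \<Rightarrow> int \<Rightarrow> int \<Rightarrow> laurent mat" where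
  "rev_Phi L n m = lmono n m \<cdot>\<^sub>m mdagger (Phi L n m)"

definition rev_tPhi :: "(laurent \<Rightarrow> complex) \<Rightarrow> int \<Rightarrow> int \<Rightarrow> laurent mat" where
  "rev_tPhi L n m = lmono n m \<cdot>\<^sub>m mdagger (tPhi L n m)"


section \<open>Recurrence coefficients\<close>

text \<open>A leading \<open>t\<close> stands for a tilde, and \<open>lmono 0 1\<close> is the variable \<open>w\<close>.\<close>

definition hat_tE :: "(laurent \<Rightarrow> complex) \<Rightarrow> int \<Rightarrow> int \<Rightarrow> complex mat" where
  "hat_tE L n m =
     vip L (lmono 0 1 \<cdot>\<^sub>m tPhi L n (m - 1)) (transpose_mat (rev_tPhi L n (m - 1)))"

definition tA :: "(laurent \<Rightarrow> complex) \<Rightarrow> int \<Rightarrow> int \<Rightarrow> complex mat" where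
  "tA L n m = vip L (lmono 0 1 \<cdot>\<^sub>m tPhi L n (m - 1)) (tPhi L n m)"

definition K :: "(laurent \<Rightarrow> complex) \<Rightarrow> int \<Rightarrow> int \<Rightarrow> complex mat" where
  "K L n m = vip L (Phi L n (m - 1)) (tPhi L (n - 1) m)"

definition K1 :: "(laurent \<Rightarrow> complex) \<Rightarrow> int \<Rightarrow> int \<Rightarrow> complex mat" where
  "K1 L n m =
     vip L (lmono 0 1 \<cdot>\<^sub>m Phi L n (m - 1)) (transpose_mat (rev_tPhi L (n - 1) m))"

definition Gam :: "(laurent \<Rightarrow> complex) \<Rightarrow> int \<Rightarrow> int \<Rightarrow> complex mat" where
  "Gam L n m = vip L (Phi L n (m - 1)) (Phi L n m)"

definition Gam1 :: "(laurent \<Rightarrow> complex) \<Rightarrow> int \<Rightarrow> int \<Rightarrow> complex mat" where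
  "Gam1 L n m = vip L (lmono 0 1 \<cdot>\<^sub>m Phi L n (m - 1)) (Phi L n m)"

definition I0 :: "(laurent \<Rightarrow> complex) \<Rightarrow> int \<Rightarrow> int \<Rightarrow> complex mat" where
  "I0 L n m = vip L (Phi L n m) (tPhi L n m)"

definition I1 :: "(laurent \<Rightarrow> complex) \<Rightarrow> int \<Rightarrow> int \<Rightarrow> complex mat" where
  "I1 L n m = vip L (transpose_mat (rev_Phi L n m)) (tPhi L n m)"

text \<open>\<^const>\<open>mat_inverse\<close> is option-valued; \<open>minv\<close> is meaningful for invertible matrices only.\<close>

definition minv :: "complex mat \<Rightarrow> complex mat" where
  "minv A = the (mat_inverse A)"

end

theory Submission
  imports Defs
begin

text \<open>Write \<open>V\<^bsub>n,m\<^esub>\<close> for the polynomials of degree at most \<open>(n, m)\<close>. The entries of \<open>\<Phi>\<^bsub>n,m\<^esub>\<close> are an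
  orthonormal basis of the complement of \<open>V\<^bsub>n-1,m\<^esub>\<close> in \<open>V\<^bsub>n,m\<^esub>\<close>, those of \<open>\<Phi>~\<^bsub>n,m\<^esub>\<close> of the complement of
  \<open>V\<^bsub>n,m-1\<^esub>\<close>, and those of the reversal of \<open>\<Phi>~\<^bsub>n,m\<^esub>\<close> of the complement of \<open>w V\<^bsub>n,m-1\<^esub>\<close>. The Gram matrix
  \<open>\<langle>w \<Phi>\<^bsub>n,m-1\<^esub>, \<Phi>\<^bsub>n,m-1\<^esub>\<rangle>\<close> is evaluated in two ways. Expanding the right factor along
  \<open>V\<^bsub>n,m\<^esub> \<supseteq> V\<^bsub>n-1,m\<^esub> \<supseteq> V\<^bsub>n-1,m-1\<^esub>\<close> gives \<open>\<Gamma>\<^sup>1 \<Gamma>\<^sup>\<dagger> + \<langle>w \<Phi>\<^bsub>n,m-1\<^esub>, \<Phi>~\<^bsub>n-1,m\<^esub>\<rangle> K\<^sup>\<dagger>\<close>; expanding the left factor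
  along \<open>V\<^bsub>n,m-1\<^esub> \<supseteq> V\<^bsub>n,m-2\<^esub> \<supseteq> V\<^bsub>n-1,m-2\<^esub>\<close> gives the first two terms of the claim. Since
  \<open>w \<Phi>\<^bsub>n,m-1\<^esub>\<close> is orthogonal to \<open>w V\<^bsub>n-1,m-1\<^esub>\<close>, the remaining Gram matrix factors through the reversal
  of \<open>\<Phi>~\<^bsub>n-1,m\<^esub>\<close>, and the three-term recurrence for \<open>\<Phi>~\<close> identifies the second factor.\<close>

section \<open>Laurent polynomials\<close>

lemma lookup_lscale [simp]: "Poly_Mapping.lookup (lscale c p) k = c * Poly_Mapping.lookup p k"
  unfolding lscale_def mult_map_scale_conv_mult [symmetric]
  by (simp add: Poly_Mapping.map.rep_eq when_def)

lemma laurent_induct [case_names zero single add]: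
  assumes "P 0" "\<And>k c. P (Poly_Mapping.single k c)" "\<And>p q. P p \<Longrightarrow> P q \<Longrightarrow> P (p + q)"
  shows "P (p :: laurent)"
proof -
  have "p = (\<Sum>k\<in>Poly_Mapping.keys p. Poly_Mapping.single k (Poly_Mapping.lookup p k))"
    by (rule poly_mapping_eqI) (auto simp: lookup_sum lookup_single when_def in_keys_iff)
  moreover have "P (\<Sum>k\<in>F. Poly_Mapping.single k (Poly_Mapping.lookup p k))" if "finite F" for F
    using that by induction (auto intro: assms)
  ultimately show ?thesis
    by (metis finite_keys)
qed

lemma lookup_ldagger_uminus:
  "Poly_Mapping.lookup (ldagger p) k = cnj (Poly_Mapping.lookup p (- k))"
  using lookup_ldagger [of p "fst k" "snd k"] by (cases k) simp

lemma ldagger_zero [simp]: "ldagger 0 = 0"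
  by (rule poly_mapping_eqI) (simp add: lookup_ldagger_uminus)

lemma ldagger_add: "ldagger (p + q) = ldagger p + ldagger q"
  by (rule poly_mapping_eqI) (simp add: lookup_ldagger_uminus lookup_add)

lemma ldagger_lscale: "ldagger (lscale c p) = lscale (cnj c) (ldagger p)"
  by (rule poly_mapping_eqI) (simp add: lookup_ldagger_uminus)

lemma ldagger_ldagger [simp]: "ldagger (ldagger p) = p"
  by (rule poly_mapping_eqI) (simp add: lookup_ldagger_uminus)

lemma ldagger_single: "ldagger (Poly_Mapping.single k c) = Poly_Mapping.single (- k) (cnj c)"
  by (rule poly_mapping_eqI) (auto simp: lookup_ldagger_uminus lookup_single when_def minus_equation_iff)

lemma ldagger_lmono: "ldagger (lmono i j) = lmono (- i) (- j)"
  by (simp add: lmono_def ldagger_single)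

lemma ldagger_mult: "ldagger (p * q) = ldagger p * ldagger q"
proof (induction p rule: laurent_induct)
  case (single k c)
  show ?case
    by (induction q rule: laurent_induct)
      (simp_all add: mult_single ldagger_single distrib_left ldagger_add)
qed (simp_all add: distrib_right ldagger_add)

lemma lmono_mult: "lmono i j * lmono k l = lmono (i + k) (j + l)"
  by (simp add: lmono_def mult_single)

lemma lmono_zero [simp]: "lmono 0 0 = 1"
  unfolding lmono_def zero_prod_def [symmetric] by (rule single_one)

lemma lookup_lmono: "Poly_Mapping.lookup (lmono i j) k = (if k = (i, j) then 1 else 0)"
  by (auto simp: lmono_def lookup_single when_def)

lemma keys_lmono [simp]: "Poly_Mapping.keys (lmono i j) = {(i, j)}"
  by (simp add: lmono_def)

lemma lookup_lmono_mult [simp]: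
  "Poly_Mapping.lookup (lmono a b * p) (i, j) = Poly_Mapping.lookup p (i - a, j - b)"
  by (induction p rule: laurent_induct)
    (auto simp: lmono_def mult_single lookup_single when_def distrib_left lookup_add)

lemma keys_lmono_mult:
  assumes "Poly_Mapping.keys p \<subseteq> S" "\<And>i j. (i, j) \<in> S \<Longrightarrow> (i + a, j + b) \<in> T"
  shows "Poly_Mapping.keys (lmono a b * p) \<subseteq> T"
proof (clarsimp simp: in_keys_iff)
  fix i j assume "Poly_Mapping.lookup p (i - a, j - b) \<noteq> 0"
  then have "(i - a, j - b) \<in> S"
    using assms(1) by (auto simp: in_keys_iff)
  then show "(i, j) \<in> T"
    using assms(2) [of "i - a" "j - b"] by simp
qed

lemma lscale_mult_left: "lscale c p * q = lscale c (p * q)"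
  by (simp add: lscale_def mult.assoc)

lemma lscale_mult_right: "p * lscale c q = lscale c (p * q)"
  by (simp add: lscale_def mult.left_commute)

lemma keys_add_subset:
  "Poly_Mapping.keys p \<subseteq> S \<Longrightarrow> Poly_Mapping.keys q \<subseteq> S \<Longrightarrow> Poly_Mapping.keys (p + q) \<subseteq> S"
  using keys_add [of p q] by blast

lemma keys_diff_subset:
  fixes p q :: laurent
  shows "Poly_Mapping.keys p \<subseteq> S \<Longrightarrow> Poly_Mapping.keys q \<subseteq> S \<Longrightarrow> Poly_Mapping.keys (p - q) \<subseteq> S"
  using keys_diff [of p q] by blast

lemma keys_lscale_subset: "Poly_Mapping.keys p \<subseteq> S \<Longrightarrow> Poly_Mapping.keys (lscale c p) \<subseteq> S"
  by (auto simp: in_keys_iff)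

lemma keys_sum_subset:
  assumes "\<And>i. i \<in> I \<Longrightarrow> Poly_Mapping.keys (f i) \<subseteq> S"
  shows "Poly_Mapping.keys (sum f I) \<subseteq> S"
  using assms by (induction I rule: infinite_finite_induct) (simp_all add: keys_add_subset)

lemma laurent_expansion:
  assumes "finite F" "Poly_Mapping.keys p \<subseteq> F"
  shows "p = (\<Sum>(i, j)\<in>F. lscale (Poly_Mapping.lookup p (i, j)) (lmono i j))"
proof (rule poly_mapping_eqI)
  fix k
  have "(\<Sum>x\<in>F. Poly_Mapping.lookup p x * (if k = x then 1 else 0)) = Poly_Mapping.lookup p k"
    using assms by (auto simp: if_distrib in_keys_iff cong: if_cong)
  then show "Poly_Mapping.lookup p k =
    Poly_Mapping.lookup (\<Sum>(i, j)\<in>F. lscale (Poly_Mapping.lookup p (i, j)) (lmono i j)) k"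
    by (simp add: lookup_sum lookup_lmono case_prod_unfold)
qed

text \<open>Lets every span condition below be handled as an inclusion of supports.\<close>

lemma mem_lspan_iff: "p \<in> lspan S \<longleftrightarrow> Poly_Mapping.keys p \<subseteq> S"
proof
  assume "p \<in> lspan S"
  then have "p \<in> laurent.span ((\<lambda>(i, j). lmono i j) ` S)"
    by (simp add: lspan_def)
  then show "Poly_Mapping.keys p \<subseteq> S"
  proof (induction rule: laurent.span_induct_alt)
    case (step c x y)
    then show ?case
      by (intro keys_add_subset keys_lscale_subset) auto
  qed simp
next
  assume S: "Poly_Mapping.keys p \<subseteq> S"
  have "(\<Sum>(i, j)\<in>Poly_Mapping.keys p. lscale (Poly_Mapping.lookup p (i, j)) (lmono i j)) \<in> lspan S"
    unfolding lspan_def using S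
    by (intro laurent.span_sum) (force intro: laurent.span_scale laurent.span_base)
  then show "p \<in> lspan S"
    using laurent_expansion [of "Poly_Mapping.keys p" p] by simp
qed

section \<open>Reversal of polynomials\<close>

text \<open>The arrow reversal for a single polynomial: an antilinear involution that reflects the
  exponent \<open>(i, j)\<close> to \<open>(n - i, m - j)\<close>.\<close>

definition reversal :: "int \<Rightarrow> int \<Rightarrow> laurent \<Rightarrow> laurent" where
  "reversal n m p = lmono n m * ldagger p"

lemma lookup_reversal:
  "Poly_Mapping.lookup (reversal n m p) (i, j) = cnj (Poly_Mapping.lookup p (n - i, m - j))"
  by (simp add: reversal_def lookup_ldagger_uminus)

lemma reversal_diff: "reversal n m (p - q) = reversal n m p - reversal n m q"
  by (rule poly_mapping_eqI) (auto simp: lookup_reversal lookup_minus)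

lemma reversal_lscale: "reversal n m (lscale c p) = lscale (cnj c) (reversal n m p)"
  by (rule poly_mapping_eqI) (auto simp: lookup_reversal)

lemma reversal_sum: "reversal n m (\<Sum>i\<in>I. f i) = (\<Sum>i\<in>I. reversal n m (f i))"
  by (rule poly_mapping_eqI) (auto simp: lookup_reversal lookup_sum)

lemma reversal_reversal [simp]: "reversal n m (reversal n m p) = p"
  by (rule poly_mapping_eqI) (auto simp: lookup_reversal)

lemma reversal_lmono_mult: "reversal n m (lmono a b * p) = reversal (n - a) (m - b) p"
  by (rule poly_mapping_eqI) (auto simp: lookup_reversal diff_diff_eq add.commute)

abbreviation grid :: "int \<Rightarrow> int \<Rightarrow> (int \<times> int) set" where
  "grid n m \<equiv> {0..n} \<times> {0..m}"

text \<open>Exponents of the product are differences of two grid points, so inner products of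
  polynomials on the grid only see the functional on its own domain.\<close>

lemma keys_mult_ldagger:
  assumes "Poly_Mapping.keys p \<subseteq> grid N M" "Poly_Mapping.keys q \<subseteq> grid N M"
  shows "p * ldagger q \<in> laurent_space N M"
proof -
  have "Poly_Mapping.keys (p * ldagger q) \<subseteq> {(i, j). \<bar>i\<bar> \<le> N \<and> \<bar>j\<bar> \<le> M}"
  proof
    fix k assume "k \<in> Poly_Mapping.keys (p * ldagger q)"
    then obtain a b where "k = a + b" "a \<in> Poly_Mapping.keys p" "b \<in> Poly_Mapping.keys (ldagger q)"
      using keys_mult by blast
    moreover from this have "- b \<in> Poly_Mapping.keys q"
      by (simp add: in_keys_iff lookup_ldagger_uminus)
    ultimately have "a \<in> grid N M" "- b \<in> grid N M" "k = a + b"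
      using assms by blast+
    then show "k \<in> {(i, j). \<bar>i\<bar> \<le> N \<and> \<bar>j\<bar> \<le> M}"
      by (cases a; cases b) auto
  qed
  then show ?thesis
    by (simp add: laurent_space_def mem_lspan_iff)
qed


section \<open>Moment functionals\<close>

text \<open>Linearity and hermitian symmetry are required on all Laurent polynomials, which makes
  \<open>ip\<close> sesquilinear without side conditions; only positivity stays tied to the grid. An
  extension argument at the end reduces the given functional to this case.\<close>

locale moment_functional =
  fixes L :: "laurent \<Rightarrow> complex" and N M :: int
  assumes L_add: "L (p + q) = L p + L q"
    and L_lscale: "L (lscale c p) = c * L p"
    and L_ldagger: "L (ldagger p) = cnj (L p)"
    and L_pos: "Poly_Mapping.keys p \<subseteq> grid N M \<Longrightarrow> p \<noteq> 0 \<Longrightarrow> 0 < L (p * ldagger p)"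
begin

section \<open>The inner product and orthogonality to spans\<close>

definition ip :: "laurent \<Rightarrow> laurent \<Rightarrow> complex" where
  "ip p q = L (p * ldagger q)"

lemma ip_commute: "ip q p = cnj (ip p q)"
  unfolding ip_def by (simp add: L_ldagger [symmetric] ldagger_mult mult.commute)

lemma ip_add_left: "ip (p + q) r = ip p r + ip q r"
  by (simp add: ip_def distrib_right L_add)

lemma ip_lscale_left: "ip (lscale c p) q = c * ip p q"
  by (simp add: ip_def lscale_mult_left L_lscale)

lemma ip_zero_left [simp]: "ip 0 q = 0"
  using ip_lscale_left [of 0 0 q] by simp

lemma ip_diff_left: "ip (p - q) r = ip p r - ip q r"
  using ip_add_left [of "p - q" q r] by simp

lemma ip_sum_left: "ip (\<Sum>i\<in>I. f i) q = (\<Sum>i\<in>I. ip (f i) q)"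
  by (induction I rule: infinite_finite_induct) (simp_all add: ip_add_left)

lemma ip_add_right: "ip p (q + r) = ip p q + ip p r"
  by (simp add: ip_def distrib_left L_add ldagger_add)

lemma ip_lscale_right: "ip p (lscale c q) = cnj c * ip p q"
  by (simp add: ip_def lscale_mult_right L_lscale ldagger_lscale)

lemma ip_zero_right [simp]: "ip p 0 = 0"
  by (simp add: ip_commute [of p])

lemma ip_sum_right: "ip p (\<Sum>i\<in>I. f i) = (\<Sum>i\<in>I. ip p (f i))"
  by (induction I rule: infinite_finite_induct) (simp_all add: ip_add_right)

text \<open>The monomial and its \<open>ldagger\<close> cancel: multiplication by a monomial is
  unitary.\<close>

lemma ip_lmono_mult: "ip (lmono a b * p) (lmono a b * q) = ip p q"
proof -
  have "(lmono a b * p) * (lmono (- a) (- b) * ldagger q)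
      = (lmono a b * lmono (- a) (- b)) * (p * ldagger q)"
    by (simp only: ac_simps)
  then show ?thesis
    by (simp add: ip_def ldagger_mult ldagger_lmono lmono_mult)
qed

lemma ip_eq_zero_imp:
  "Poly_Mapping.keys p \<subseteq> grid N M \<Longrightarrow> ip p p = 0 \<Longrightarrow> p = 0"
  using L_pos [of p] by (auto simp: ip_def)

definition orth :: "laurent \<Rightarrow> (int \<times> int) set \<Rightarrow> bool" where
  "orth p S \<longleftrightarrow> (\<forall>q. Poly_Mapping.keys q \<subseteq> S \<longrightarrow> ip p q = 0)"

lemma orthD: "orth p S \<Longrightarrow> Poly_Mapping.keys q \<subseteq> S \<Longrightarrow> ip p q = 0"
  by (simp add: orth_def)

lemma orth_commuteD: "orth p S \<Longrightarrow> Poly_Mapping.keys q \<subseteq> S \<Longrightarrow> ip q p = 0"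
  by (simp add: orth_def ip_commute [of q])

lemma orth_mono: "orth p S \<Longrightarrow> T \<subseteq> S \<Longrightarrow> orth p T"
  by (auto simp: orth_def)

lemma orth_iff:
  "orth p S \<longleftrightarrow> (\<forall>(i, j)\<in>S. ip p (lmono i j) = 0)"
proof
  assume R: "\<forall>(i, j)\<in>S. ip p (lmono i j) = 0"
  show "orth p S"
    unfolding orth_def
  proof (intro allI impI)
    fix q :: laurent assume S: "Poly_Mapping.keys q \<subseteq> S"
    have "ip p q = ip p (\<Sum>(i, j)\<in>Poly_Mapping.keys q.
        lscale (Poly_Mapping.lookup q (i, j)) (lmono i j))"
      using laurent_expansion [of "Poly_Mapping.keys q" q] by simp
    also have "\<dots> = 0"
      unfolding ip_sum_right using R S
      by (intro sum.neutral) (fastforce simp: ip_lscale_right)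
    finally show "ip p q = 0" .
  qed
qed (auto simp: orth_def)

lemma orth_zero: "Poly_Mapping.keys p \<subseteq> S \<Longrightarrow> S \<subseteq> grid N M \<Longrightarrow> orth p S \<Longrightarrow> p = 0"
  by (rule ip_eq_zero_imp) (simp_all add: orthD)

lemma orth_diff: "orth p S \<Longrightarrow> orth q S \<Longrightarrow> orth (p - q) S"
  by (simp add: orth_def ip_diff_left)

lemma orth_lscale: "orth p S \<Longrightarrow> orth (lscale c p) S"
  by (simp add: orth_def ip_lscale_left)

lemma orth_sum: "(\<And>i. i \<in> I \<Longrightarrow> orth (f i) S) \<Longrightarrow> orth (\<Sum>i\<in>I. f i) S"
  by (simp add: orth_def ip_sum_left)

section \<open>Existence and uniqueness of the orthonormal polynomials\<close>

text \<open>Gram-Schmidt, one monomial at a time. The new monomial minus its projection is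
  \<open>e\<close>; its coefficient at \<open>k\<close> is 1, so it is nonzero and positivity allows
  division by \<open>ip e e\<close>.\<close>

lemma projection_exists:
  assumes "finite S" "S \<subseteq> grid N M"
  shows "\<exists>r. Poly_Mapping.keys r \<subseteq> S \<and> orth (q - r) S"
  using assms
proof (induction S arbitrary: q rule: finite_induct)
  case empty
  show ?case by (auto simp: orth_def intro!: exI [of _ 0])
next
  case (insert k S)
  obtain a b where k: "k = (a, b)" by (cases k)
  obtain s where s: "Poly_Mapping.keys s \<subseteq> S" "orth (lmono a b - s) S"
    using insert.IH [of "lmono a b"] insert.prems by auto
  obtain r where r: "Poly_Mapping.keys r \<subseteq> S" "orth (q - r) S"
    using insert.IH [of q] insert.prems by auto
  define e where "e = lmono a b - s"
  have e: "Poly_Mapping.keys e \<subseteq> insert k S"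
    unfolding e_def using s k by (intro keys_diff_subset) auto
  have "Poly_Mapping.lookup e k = 1"
    using s(1) insert.hyps k by (auto simp: e_def lookup_minus lookup_lmono in_keys_iff)
  then have "e \<noteq> 0" by auto
  then have ne: "ip e e \<noteq> 0"
    using ip_eq_zero_imp e insert.prems by blast
  define t where "t = r + lscale (ip (q - r) e / ip e e) e"
  have "Poly_Mapping.keys t \<subseteq> insert k S"
    unfolding t_def using r e by (intro keys_add_subset keys_lscale_subset) auto
  moreover have "orth (q - t) (insert k S)"
  proof -
    have qt: "q - t = (q - r) - lscale (ip (q - r) e / ip e e) e"
      by (simp add: t_def)
    have o: "orth (q - t) S"
      unfolding qt using s(2) r(2)
        by (simp add: e_def orth_diff orth_lscale del: diff_diff_eq diff_diff_add)
    \<comment> \<open>\<open>e + s\<close> is the new monomial itself, and the coefficient in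
      \<open>t\<close> was chosen to make \<open>q - t\<close> orthogonal to
      \<open>e\<close>.\<close>
    have "ip (q - t) (e + s) = 0"
      using orthD [OF o s(1)] ne by (simp add: ip_add_right) (simp add: qt ip_diff_left ip_lscale_left)
    then show ?thesis
      using o by (simp add: orth_iff k e_def)
  qed
  ultimately show ?case by blast
qed

text \<open>Scale \<open>q\<close> to the coefficient of \<open>p\<close> at \<open>k\<close>. The
  difference is supported in \<open>S - {k}\<close> and orthogonal to it, hence zero; norm one and
  positivity then force the factor 1.\<close>

lemma orthopoly_unique:
  assumes "S \<subseteq> grid N M" "k \<in> S"
    and p: "Poly_Mapping.keys p \<subseteq> S" "0 < Poly_Mapping.lookup p k" "ip p p = 1" "orth p (S - {k})"
    and q: "Poly_Mapping.keys q \<subseteq> S" "0 < Poly_Mapping.lookup q k" "ip q q = 1" "orth q (S - {k})"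
  shows "p = q"
proof -
  define c where "c = Poly_Mapping.lookup p k / Poly_Mapping.lookup q k"
  have c: "0 < c"
    using p q by (auto simp: c_def less_complex_def complex_is_Real_iff Re_divide Im_divide)
  have "Poly_Mapping.keys (p - lscale c q) \<subseteq> S"
    using p q by (intro keys_diff_subset keys_lscale_subset)
  moreover have "Poly_Mapping.lookup (p - lscale c q) k = 0"
    using q by (auto simp: c_def lookup_minus)
  ultimately have "Poly_Mapping.keys (p - lscale c q) \<subseteq> S - {k}"
    by (auto simp: in_keys_iff)
  then have "p - lscale c q = 0"
    using assms by (intro orth_zero [of _ "S - {k}"] orth_diff orth_lscale) auto
  then have pq: "p = lscale c q" by simp
  have "c * cnj c = 1"
    using p(3) q(3) by (simp add: pq ip_lscale_left ip_lscale_right mult.commute)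
  then have "Re c * Re c = 1" "Im c = 0"
    using c by (auto simp: complex_eq_iff less_complex_def)
  then have "c = 1"
    using c by (auto simp: complex_eq_iff less_complex_def square_eq_1_iff)
  then show ?thesis by (simp add: pq)
qed

lemma orthopoly_exists:
  assumes "S \<subseteq> grid N M" "k \<in> S"
  obtains p where "Poly_Mapping.keys p \<subseteq> S" "0 < Poly_Mapping.lookup p k" "ip p p = 1"
    "orth p (S - {k})"
proof -
  obtain a b where k: "k = (a, b)" by (cases k)
  have "finite S"
    using assms(1) by (rule finite_subset) simp
  then obtain r where r: "Poly_Mapping.keys r \<subseteq> S - {k}" "orth (lmono a b - r) (S - {k})"
    using projection_exists [of "S - {k}" "lmono a b"] assms by auto
  define e where "e = lmono a b - r"
  have e: "Poly_Mapping.keys e \<subseteq> S"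
    unfolding e_def using r k assms by (intro keys_diff_subset) auto
  have ek: "Poly_Mapping.lookup e k = 1"
    using r(1) k by (auto simp: e_def lookup_minus lookup_lmono in_keys_iff)
  then have "e \<noteq> 0" by auto
  then have pos: "0 < ip e e"
    using L_pos e assms(1) by (simp add: ip_def)
  define c where "c = 1 / sqrt (Re (ip e e))"
  have c: "0 < c" "complex_of_real (c * c) * ip e e = 1"
    using pos by (auto simp: c_def less_complex_def complex_eq_iff field_simps)
  show thesis
  proof (rule that [of "lscale c e"])
    show "ip (lscale c e) (lscale c e) = 1"
      using c(2) by (simp add: ip_lscale_left ip_lscale_right mult.assoc)
    show "orth (lscale c e) (S - {k})"
      using r by (auto simp: e_def intro: orth_lscale)
    show "0 < Poly_Mapping.lookup (lscale c e) k"
      using ek c by (simp add: less_complex_def)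
  qed (rule keys_lscale_subset [OF e])
qed

lemma orthopoly:
  assumes "S \<subseteq> grid N M" "k \<in> S"
  shows "Poly_Mapping.keys (orthopoly L S k) \<subseteq> S" "0 < Poly_Mapping.lookup (orthopoly L S k) k"
    "ip (orthopoly L S k) (orthopoly L S k) = 1" "orth (orthopoly L S k) (S - {k})"
proof -
  let ?P = "\<lambda>p. Poly_Mapping.keys p \<subseteq> S \<and> 0 < Poly_Mapping.lookup p k \<and> ip p p = 1 \<and> orth p (S - {k})"
  obtain p where "?P p"
    using orthopoly_exists [OF assms] by blast
  then have "\<exists>!p. ?P p"
    using orthopoly_unique [OF assms] by (intro ex1I [of ?P p]) simp_all
  moreover have "orthopoly L S k = (THE p. ?P p)"
    by (simp add: orthopoly_def mem_lspan_iff orth_iff ip_def case_prod_unfold)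
  ultimately have "?P (orthopoly L S k)"
    using theI' [of ?P] by simp
  then show "Poly_Mapping.keys (orthopoly L S k) \<subseteq> S" "0 < Poly_Mapping.lookup (orthopoly L S k) k"
    "ip (orthopoly L S k) (orthopoly L S k) = 1" "orth (orthopoly L S k) (S - {k})"
    by auto
qed

text \<open>Removing the multiple of the orthonormal polynomial that matches \<open>f\<close> at
  \<open>k\<close> leaves a remainder supported in \<open>S - {k}\<close>, hence orthogonal to
  it.\<close>

lemma ip_orthopoly:
  assumes "S \<subseteq> grid N M" "k \<in> S" "Poly_Mapping.keys f \<subseteq> S"
  shows "ip f (orthopoly L S k) = Poly_Mapping.lookup f k / Poly_Mapping.lookup (orthopoly L S k) k"
proof -
  define p where "p = orthopoly L S k"
  note p = orthopoly [OF assms(1,2), folded p_def]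
  define \<alpha> where "\<alpha> = Poly_Mapping.lookup f k / Poly_Mapping.lookup p k"
  have "Poly_Mapping.keys (f - lscale \<alpha> p) \<subseteq> S"
    using assms(3) p(1) by (intro keys_diff_subset keys_lscale_subset)
  moreover have "Poly_Mapping.lookup (f - lscale \<alpha> p) k = 0"
    using p(2) by (auto simp: \<alpha>_def lookup_minus)
  ultimately have *: "Poly_Mapping.keys (f - lscale \<alpha> p) \<subseteq> S - {k}"
    by (auto simp: in_keys_iff)
  show ?thesis
    using orth_commuteD [OF p(4) *] p(3) by (simp add: ip_diff_left ip_lscale_left \<alpha>_def p_def)
qed

subsection \<open>Orthonormal bases of complements\<close>

text \<open>\<open>b 0, \<dots>, b (d - 1)\<close> is an orthonormal basis of the complement of the span of \<open>S0\<close> in the span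
  of \<open>S\<close>; that it spans the complement is expressed through the remainder of the projection.\<close>

definition onb ::
  "(int \<times> int) set \<Rightarrow> (int \<times> int) set \<Rightarrow> (nat \<Rightarrow> laurent) \<Rightarrow> nat \<Rightarrow> bool" where
  "onb S0 S b d \<longleftrightarrow>
     (\<forall>r<d. Poly_Mapping.keys (b r) \<subseteq> S \<and> orth (b r) S0) \<and>
     (\<forall>r<d. \<forall>s<d. ip (b r) (b s) = (if r = s then 1 else 0)) \<and>
     (\<forall>f. Poly_Mapping.keys f \<subseteq> S \<longrightarrow>
        Poly_Mapping.keys (f - (\<Sum>r<d. lscale (ip f (b r)) (b r))) \<subseteq> S0)"

lemma onbD:
  assumes "onb S0 S b d"
  shows onb_keys: "r < d \<Longrightarrow> Poly_Mapping.keys (b r) \<subseteq> S"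
    and onb_orth: "r < d \<Longrightarrow> orth (b r) S0"
    and onb_ip: "r < d \<Longrightarrow> s < d \<Longrightarrow> ip (b r) (b s) = (if r = s then 1 else 0)"
    and onb_proj: "Poly_Mapping.keys f \<subseteq> S \<Longrightarrow>
        Poly_Mapping.keys (f - (\<Sum>r<d. lscale (ip f (b r)) (b r))) \<subseteq> S0"
  using assms by (auto simp: onb_def)

text \<open>Gram-Schmidt along the enumeration \<open>c\<close> of the added exponents: the
  \<open>r\<close>-th vector uses \<open>S0\<close> and \<open>c 0, ..., c r\<close>, with
  \<open>c r\<close> leading.\<close>

lemma onb_orthopoly:
  assumes "inj_on c {..<d}" "c ` {..<d} \<inter> S0 = {}" "S0 \<union> c ` {..<d} \<subseteq> grid N M"
  shows "onb S0 (S0 \<union> c ` {..<d}) (\<lambda>r. orthopoly L (S0 \<union> c ` {..<Suc r}) (c r)) d"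
  using assms
proof (induction d)
  case 0
  then show ?case by (simp add: onb_def)
next
  case (Suc d)
  define b where "b = (\<lambda>r. orthopoly L (S0 \<union> c ` {..<Suc r}) (c r))"
  define S where "S = S0 \<union> c ` {..<d}"
  define T where "T = S0 \<union> c ` {..<Suc d}"
  have T: "T = insert (c d) S" "S \<subseteq> T"
    by (auto simp: S_def T_def lessThan_Suc)
  have cd: "c d \<notin> S"
    using Suc.prems by (auto simp: S_def lessThan_Suc)
  have IH: "onb S0 S b d"
    unfolding b_def S_def using Suc.prems
    by (intro Suc.IH) (auto simp: lessThan_Suc)
  have bd: "b d = orthopoly L T (c d)"
    by (simp add: b_def T_def)
  have TS: "T - {c d} = S"
    using T cd by auto
  have "T \<subseteq> grid N M" "c d \<in> T"
    using Suc.prems(3) unfolding T_def by auto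
  note * = orthopoly [OF this, folded bd, unfolded TS]
  have "onb S0 T b (Suc d)"
    unfolding onb_def
  proof (intro conjI allI impI)
    fix r assume "r < Suc d"
    then show "Poly_Mapping.keys (b r) \<subseteq> T" "orth (b r) S0"
      using onb_keys [OF IH] onb_orth [OF IH] * T orth_mono [of "b d" S S0]
      by (auto simp: less_Suc_eq S_def)
  next
    have "ip (b d) (b r) = 0" "ip (b r) (b d) = 0" if "r < d" for r
      using onb_keys [OF IH that] *(4) by (simp_all add: orthD orth_commuteD)
    then show "ip (b r) (b s) = (if r = s then 1 else 0)" if "r < Suc d" "s < Suc d" for r s
      using onb_ip [OF IH] *(3) that by (auto simp: less_Suc_eq)
  next
    fix f :: laurent assume f: "Poly_Mapping.keys f \<subseteq> T"
    define \<alpha> where "\<alpha> = Poly_Mapping.lookup f (c d) / Poly_Mapping.lookup (b d) (c d)"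
    define g where "g = f - lscale \<alpha> (b d)"
    have "Poly_Mapping.keys g \<subseteq> T"
      unfolding g_def using f * by (intro keys_diff_subset keys_lscale_subset)
    moreover have "Poly_Mapping.lookup g (c d) = 0"
      using *(2) by (auto simp: g_def \<alpha>_def lookup_minus)
    ultimately have g: "Poly_Mapping.keys g \<subseteq> S"
      unfolding TS [symmetric] by (auto simp: in_keys_iff)
    have "ip f (b d) = \<alpha>"
      using orth_commuteD [OF *(4) g] *(3) by (simp add: g_def ip_diff_left ip_lscale_left)
    moreover have "ip g (b r) = ip f (b r)" if "r < d" for r
      using orthD [OF *(4) onb_keys [OF IH that]] by (simp add: g_def ip_diff_left ip_lscale_left)
    \<comment> \<open>The new vector clears the coefficient at \<open>c d\<close>; being orthogonal
      to the earlier vectors, it leaves their coefficients unchanged.\<close>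
    ultimately have "f - (\<Sum>r<Suc d. lscale (ip f (b r)) (b r))
        = g - (\<Sum>r<d. lscale (ip g (b r)) (b r))"
      by (simp add: g_def)
    then show "Poly_Mapping.keys (f - (\<Sum>r<Suc d. lscale (ip f (b r)) (b r))) \<subseteq> S0"
      using onb_proj [OF IH g] by simp
  qed
  then show ?case
    by (simp add: b_def T_def)
qed

text \<open>\<open>Phi\<close> and \<open>tPhi\<close> list their entries by decreasing index,
  Gram-Schmidt by increasing index.\<close>

lemma onb_rev:
  assumes "onb S0 S b d"
  shows "onb S0 S (\<lambda>r. b (d - Suc r)) d"
proof -
  have "(\<Sum>r<d. lscale (ip f (b (d - Suc r))) (b (d - Suc r))) = (\<Sum>r<d. lscale (ip f (b r)) (b r))" for f
    by (rule sum.nat_diff_reindex)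
  then show ?thesis
    using assms unfolding onb_def by auto
qed

lemma onb_cong:
  assumes "onb S0 S b d" "\<And>r. r < d \<Longrightarrow> b r = b' r"
  shows "onb S0 S b' d"
  using assms unfolding onb_def by simp

section \<open>Reversals of orthonormal bases\<close>

text \<open>Reversal is antiunitary, hence the exchanged arguments.\<close>

lemma ip_reversal: "ip (reversal n m p) (reversal n m q) = ip q p"
  unfolding reversal_def ip_lmono_mult by (simp add: ip_def mult.commute)

lemma ip_reversal_right: "ip p (reversal n m q) = ip q (reversal n m p)"
  using ip_reversal [of n m "reversal n m p" q] by simp

lemma ip_reversal_left: "ip (reversal n m p) q = ip (reversal n m q) p"
  using ip_reversal [of n m p "reversal n m q"] by simp

lemma keys_reversal:
  assumes "Poly_Mapping.keys p \<subseteq> S"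
  shows "Poly_Mapping.keys (reversal n m p) \<subseteq> (\<lambda>(i, j). (n - i, m - j)) ` S"
proof (clarsimp simp: in_keys_iff lookup_reversal)
  fix i j assume "Poly_Mapping.lookup p (n - i, m - j) \<noteq> 0"
  then have "(n - i, m - j) \<in> S"
    using assms by (auto simp: in_keys_iff)
  then show "(i, j) \<in> (\<lambda>(i, j). (n - i, m - j)) ` S"
    by (force intro: rev_image_eqI)
qed

lemma onb_reversal:
  assumes "onb S0 S b d"
  shows "onb ((\<lambda>(i, j). (n - i, m - j)) ` S0) ((\<lambda>(i, j). (n - i, m - j)) ` S)
    (\<lambda>r. reversal n m (b r)) d"
proof -
  have "(\<lambda>(i, j). (n - i, m - j)) ` (\<lambda>(i, j). (n - i, m - j)) ` T = T" for T
    by (force simp: image_image case_prod_unfold)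
  then have keys: "Poly_Mapping.keys (reversal n m q) \<subseteq> T"
    if "Poly_Mapping.keys q \<subseteq> (\<lambda>(i, j). (n - i, m - j)) ` T" for q T
    using keys_reversal [OF that, of n m] by simp
  show ?thesis
    unfolding onb_def
  proof (intro conjI allI impI)
    fix r assume r: "r < d"
    show "Poly_Mapping.keys (reversal n m (b r)) \<subseteq> (\<lambda>(i, j). (n - i, m - j)) ` S"
      using onb_keys [OF assms r] by (rule keys_reversal)
    show "orth (reversal n m (b r)) ((\<lambda>(i, j). (n - i, m - j)) ` S0)"
      unfolding orth_def using onb_orth [OF assms r] keys
      by (metis ip_reversal_left orth_commuteD)
  next
    show "ip (reversal n m (b r)) (reversal n m (b s)) = (if r = s then 1 else 0)"
      if "r < d" "s < d" for r s
      using onb_ip [OF assms] that by (simp add: ip_reversal)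
  next
    fix f :: laurent assume "Poly_Mapping.keys f \<subseteq> (\<lambda>(i, j). (n - i, m - j)) ` S"
    then have "Poly_Mapping.keys (reversal n m f) \<subseteq> S"
      by (rule keys)
    note onb_proj [OF assms this, THEN keys_reversal, of n m]
    \<comment> \<open>Antilinearity of the reversal conjugates the coefficients; this turns them
      into coefficients of \<open>f\<close> itself.\<close>
    moreover have "cnj (ip (reversal n m f) p) = ip f (reversal n m p)" for p
      by (subst ip_commute [symmetric]) (rule ip_reversal_right)
    ultimately show "Poly_Mapping.keys (f - (\<Sum>r<d. lscale (ip f (reversal n m (b r))) (reversal n m (b r))))
        \<subseteq> (\<lambda>(i, j). (n - i, m - j)) ` S0"
      by (simp add: reversal_diff reversal_sum reversal_lscale)
  qed
qed

section \<open>Parseval identities\<close>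

text \<open>The remainder of the projection of \<open>f\<close> lies in the span of
  \<open>S0\<close>, which \<open>g\<close> annihilates.\<close>

lemma onb_parseval:
  assumes "onb S0 S b d" "Poly_Mapping.keys f \<subseteq> S" "orth g S0"
  shows "ip f g = (\<Sum>r<d. ip f (b r) * ip (b r) g)"
  using orth_commuteD [OF assms(3) onb_proj [OF assms(1,2)]]
  by (simp add: ip_diff_left ip_sum_left ip_lscale_left)

text \<open>Projecting along both levels leaves a remainder supported in \<open>S0\<close> and
  orthogonal to it, hence zero; this expands \<open>f\<close> itself, so every \<open>g\<close> can
  be paired with it.\<close>

lemma onb_parseval2:
  assumes b: "onb S1 S b d" and c: "onb S0 S1 c e"
    and f: "Poly_Mapping.keys f \<subseteq> S" "orth f S0" and "S0 \<subseteq> S1" "S1 \<subseteq> grid N M"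
  shows "ip f g = (\<Sum>r<d. ip f (b r) * ip (b r) g) + (\<Sum>r<e. ip f (c r) * ip (c r) g)"
proof -
  define f1 where "f1 = f - (\<Sum>r<d. lscale (ip f (b r)) (b r))"
  define f2 where "f2 = f1 - (\<Sum>r<e. lscale (ip f1 (c r)) (c r))"
  have f1: "Poly_Mapping.keys f1 \<subseteq> S1"
    unfolding f1_def using b f(1) by (rule onb_proj)
  have ip1: "ip f1 (c r) = ip f (c r)" if "r < e" for r
    using orthD [OF onb_orth [OF b] onb_keys [OF c that]]
    by (simp add: f1_def ip_diff_left ip_sum_left ip_lscale_left)
  have "Poly_Mapping.keys f2 \<subseteq> S0"
    unfolding f2_def using c f1 by (rule onb_proj)
  moreover have "orth f2 S0"
    unfolding f2_def f1_def using f(2) onb_orth [OF b] onb_orth [OF c] assms(5)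
    by (auto intro!: orth_diff [OF orth_diff] orth_sum orth_lscale intro: orth_mono)
  ultimately have "f2 = 0"
    using assms(5,6) orth_zero by blast
  then have "f = (\<Sum>r<d. lscale (ip f (b r)) (b r)) + (\<Sum>r<e. lscale (ip f (c r)) (c r))"
    using ip1 by (simp add: f2_def f1_def algebra_simps)
  then have "ip f g = ip ((\<Sum>r<d. lscale (ip f (b r)) (b r)) + (\<Sum>r<e. lscale (ip f (c r)) (c r))) g"
    by (rule arg_cong)
  then show ?thesis
    by (simp add: ip_add_left ip_sum_left ip_lscale_left)
qed

section \<open>The bases given by \<open>Phi\<close>, \<open>tPhi\<close> and the reversal of
  \<open>tPhi\<close>\<close>

text \<open>The exponents \<open>(n, 0), ..., (n, m)\<close> are added to the smaller grid in this
  order. For \<open>m = -1\<close> both grids and the basis are empty.\<close>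

lemma onb_phi:
  assumes "0 \<le> n" "n \<le> N" "- 1 \<le> m" "m \<le> M"
  shows "onb (grid (n - 1) m) (grid n m) (\<lambda>r. phi L n m (m - int r)) (nat (m + 1))"
proof -
  let ?d = "nat (m + 1)" and ?c = "\<lambda>r::nat. (n, int r)" and ?S0 = "grid (n - 1) m"
  have img: "?c ` {..<r} = {(n, j) |j. 0 \<le> j \<and> j < int r}" for r
    by (auto simp: image_iff intro!: bexI [of _ "nat _"])
  have S: "?S0 \<union> ?c ` {..<?d} = grid n m"
    using assms unfolding img by auto
  have "onb ?S0 (?S0 \<union> ?c ` {..<?d}) (\<lambda>r. orthopoly L (?S0 \<union> ?c ` {..<Suc r}) (?c r)) ?d"
    using assms by (intro onb_orthopoly) (auto simp: inj_on_def)
  moreover have "orthopoly L (?S0 \<union> ?c ` {..<Suc r}) (?c r) = phi L n m (int r)" for r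
    unfolding phi_def img by (intro arg_cong2 [where f = "orthopoly L"]) auto
  ultimately have "onb ?S0 (grid n m) (\<lambda>r. phi L n m (int r)) ?d"
    by (simp add: S)
  then show ?thesis
    by (rule onb_cong [OF onb_rev]) (simp add: of_nat_diff)
qed

lemma onb_tphi:
  assumes "- 1 \<le> n" "n \<le> N" "0 \<le> m" "m \<le> M"
  shows "onb (grid n (m - 1)) (grid n m) (\<lambda>r. tphi L n m (n - int r)) (nat (n + 1))"
proof -
  let ?d = "nat (n + 1)" and ?c = "\<lambda>r::nat. (int r, m)" and ?S0 = "grid n (m - 1)"
  have img: "?c ` {..<r} = {(i, m) |i. 0 \<le> i \<and> i < int r}" for r
    by (auto simp: image_iff intro!: bexI [of _ "nat _"])
  have S: "?S0 \<union> ?c ` {..<?d} = grid n m"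
    using assms unfolding img by auto
  have "onb ?S0 (?S0 \<union> ?c ` {..<?d}) (\<lambda>r. orthopoly L (?S0 \<union> ?c ` {..<Suc r}) (?c r)) ?d"
    using assms by (intro onb_orthopoly) (auto simp: inj_on_def)
  moreover have "orthopoly L (?S0 \<union> ?c ` {..<Suc r}) (?c r) = tphi L n m (int r)" for r
    unfolding tphi_def img by (intro arg_cong2 [where f = "orthopoly L"]) auto
  ultimately have "onb ?S0 (grid n m) (\<lambda>r. tphi L n m (int r)) ?d"
    by (simp add: S)
  then show ?thesis
    by (rule onb_cong [OF onb_rev]) (simp add: of_nat_diff)
qed

text \<open>The reflection of exponents preserves the grid and sends its rows
  \<open>0..m - 1\<close> to the rows \<open>1..m\<close>, that is, to their shift by
  \<open>w\<close>.\<close>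

lemma onb_reversal_tphi:
  assumes "- 1 \<le> n" "n \<le> N" "0 \<le> m" "m \<le> M"
  shows "onb ({0..n} \<times> {1..m}) (grid n m) (\<lambda>r. reversal n m (tphi L n m (n - int r))) (nat (n + 1))"
proof -
  have "(i, j) \<in> (\<lambda>(i, j). (n - i, m - j)) ` ({0..n} \<times> {a..b})"
    if "i \<in> {0..n}" "j \<in> {m - b..m - a}" for a b i j
    using that by (intro image_eqI [of _ _ "(n - i, m - j)"]) auto
  then have r: "(\<lambda>(i, j). (n - i, m - j)) ` ({0..n} \<times> {a..b}) = {0..n} \<times> {m - b..m - a}" for a b
    by auto
  show ?thesis
    using onb_reversal [OF onb_tphi [OF assms], of n m] by (simp add: r)
qed

end

section \<open>Gram matrices\<close>

definition gram ::
  "(laurent \<Rightarrow> complex) \<Rightarrow> nat \<Rightarrow> nat \<Rightarrow> (nat \<Rightarrow> laurent) \<Rightarrow> (nat \<Rightarrow> laurent) \<Rightarrow> complex mat" where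
  "gram L d e f g = mat d e (\<lambda>(i, j). L (f i * ldagger (g j)))"

lemma gram_carrier [simp]: "gram L d e f g \<in> carrier_mat d e"
  by (simp add: gram_def)

lemma gram_dim [simp]: "dim_row (gram L d e f g) = d" "dim_col (gram L d e f g) = e"
  by (simp_all add: gram_def)

lemma mat_adjoint_index:
  assumes "i < dim_col A" "j < dim_row A"
  shows "mat_adjoint A $$ (i, j) = conjugate (A $$ (j, i))"
  using assms unfolding mat_adjoint_def by (simp add: mat_of_rows_index)

lemma mat_adjoint_dim [simp]:
  "dim_row (mat_adjoint A) = dim_col A" "dim_col (mat_adjoint A) = dim_row A"
  by (simp_all add: mat_adjoint_def)

definition column :: "nat \<Rightarrow> (nat \<Rightarrow> laurent) \<Rightarrow> laurent mat" where
  "column d f = mat d 1 (\<lambda>(r, _). f r)"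

lemma vip_column: "vip L (column d f) (column e g) = gram L d e f g"
  by (rule eq_matI) (simp_all add: vip_def column_def gram_def mdagger_def scalar_prod_def)

lemma smult_column: "p \<cdot>\<^sub>m column d f = column d (\<lambda>r. p * f r)"
  by (rule eq_matI) (simp_all add: column_def)

lemma rev_column: "transpose_mat (lmono n m \<cdot>\<^sub>m mdagger (column d f)) = column d (\<lambda>r. reversal n m (f r))"
  by (rule eq_matI) (simp_all add: column_def mdagger_def reversal_def)

lemma Phi_column: "Phi L n m = column (nat (m + 1)) (\<lambda>r. phi L n m (m - int r))"
  by (simp add: Phi_def column_def)

lemma tPhi_column: "tPhi L n m = column (nat (n + 1)) (\<lambda>r. tphi L n m (n - int r))"
  by (simp add: tPhi_def column_def)

lemma coefficient_gram:
  shows hat_tE_gram: "hat_tE L n m = gram L (nat (n + 1)) (nat (n + 1))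
      (\<lambda>r. lmono 0 1 * tphi L n (m - 1) (n - int r))
      (\<lambda>r. reversal n (m - 1) (tphi L n (m - 1) (n - int r)))"
    and tA_gram: "tA L n m = gram L (nat (n + 1)) (nat (n + 1))
      (\<lambda>r. lmono 0 1 * tphi L n (m - 1) (n - int r)) (\<lambda>r. tphi L n m (n - int r))"
    and K_gram: "K L n m = gram L (nat m) (nat n)
      (\<lambda>r. phi L n (m - 1) (m - 1 - int r)) (\<lambda>r. tphi L (n - 1) m (n - 1 - int r))"
    and K1_gram: "K1 L n m = gram L (nat m) (nat n)
      (\<lambda>r. lmono 0 1 * phi L n (m - 1) (m - 1 - int r))
      (\<lambda>r. reversal (n - 1) m (tphi L (n - 1) m (n - 1 - int r)))"
    and Gam_gram: "Gam L n m = gram L (nat m) (nat (m + 1))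
      (\<lambda>r. phi L n (m - 1) (m - 1 - int r)) (\<lambda>r. phi L n m (m - int r))"
    and Gam1_gram: "Gam1 L n m = gram L (nat m) (nat (m + 1))
      (\<lambda>r. lmono 0 1 * phi L n (m - 1) (m - 1 - int r)) (\<lambda>r. phi L n m (m - int r))"
    and I0_gram: "I0 L n m = gram L (nat (m + 1)) (nat (n + 1))
      (\<lambda>r. phi L n m (m - int r)) (\<lambda>r. tphi L n m (n - int r))"
    and I1_gram: "I1 L n m = gram L (nat (m + 1)) (nat (n + 1))
      (\<lambda>r. reversal n m (phi L n m (m - int r))) (\<lambda>r. tphi L n m (n - int r))"
  by (simp_all add: hat_tE_def tA_def K_def K1_def Gam_def Gam1_def I0_def I1_def rev_Phi_def
    rev_tPhi_def Phi_column tPhi_column smult_column rev_column vip_column)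

section \<open>Matrix algebra for the elimination step and the inverse\<close>

lemma mat_add_eqD:
  fixes X Y Z :: "'a :: ab_group_add mat"
  assumes "X + Y = Z" "X \<in> carrier_mat m n" "Y \<in> carrier_mat m n"
  shows "X = Z + - Y"
  unfolding assms(1) [symmetric] using assms(2,3) by (intro eq_matI) auto

text \<open>\<open>B\<close> inverts \<open>A\<close>, so the second relation gives
  \<open>B * (H * D) = - Q\<close>. This removes the auxiliary Gram matrix \<open>Q\<close> from the
  final identity.\<close>

lemma mat_eliminate:
  fixes A :: "'a :: comm_ring_1 mat"
  assumes "C \<in> carrier_mat d n" "B \<in> carrier_mat n n" "A \<in> carrier_mat n n" "Q \<in> carrier_mat n n"
    "H \<in> carrier_mat n n" "D \<in> carrier_mat n n" "E \<in> carrier_mat n e"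
    and "B * A = 1\<^sub>m n" "A * Q + H * D = 0\<^sub>m n n"
  shows "C * B * H * D * E = - (C * Q * E)"
proof -
  have "A * Q = - (H * D)"
    using mat_add_eqD [OF assms(9), of n n] assms by simp
  then have "B * (H * D) = - (B * (A * Q))"
    using assms by simp
  also have "B * (A * Q) = Q"
    using assms by (simp add: assoc_mult_mat [symmetric])
  finally have BHD: "B * (H * D) = - Q" .
  have "C * B * H * D * E = C * (B * (H * D)) * E"
    using assms by (simp add: assoc_mult_mat [of _ d n _ n _ n] assoc_mult_mat [of _ n n _ n _ n])
  then show ?thesis
    using assms by (simp add: BHD)
qed

lemma minv_left_inverse:
  assumes "A \<in> carrier_mat n n" "det A \<noteq> 0"
  shows "minv A \<in> carrier_mat n n" "minv A * A = 1\<^sub>m n"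
proof -
  obtain B where "mat_inverse A = Some B"
    using mat_inverse(1) [OF assms(1), of "()"] det_non_zero_imp_unit [OF assms, of "()"] by blast
  then show "minv A \<in> carrier_mat n n" "minv A * A = 1\<^sub>m n"
    using mat_inverse(2) [OF assms(1)] by (auto simp: minv_def)
qed

section \<open>Parseval for Gram matrices and shifts by monomials\<close>

context moment_functional begin

lemma gram_ip: "gram L d e f g = mat d e (\<lambda>(i, j). ip (f i) (g j))"
  by (simp add: gram_def ip_def)

lemma mat_adjoint_gram: "mat_adjoint (gram L d e f g) = gram L e d g f"
  by (rule eq_matI) (simp_all add: mat_adjoint_index, simp add: gram_ip ip_commute [symmetric])

lemma gram_parseval:
  assumes "onb S0 S b k" "\<And>j. j < e \<Longrightarrow> Poly_Mapping.keys (g j) \<subseteq> S" "\<And>i. i < d \<Longrightarrow> orth (f i) S0"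
  shows "gram L d e f g = gram L d k f b * gram L k e b g"
proof -
  \<comment> \<open>\<open>onb_parseval\<close> expands the first argument; conjugation moves the
    expansion to the second one.\<close>
  have "ip (f i) (g j) = (\<Sum>r<k. ip (f i) (b r) * ip (b r) (g j))" if "i < d" "j < e" for i j
    using onb_parseval [OF assms(1) assms(2) [OF that(2)] assms(3) [OF that(1)], THEN arg_cong [where f = cnj]]
    by (simp add: ip_commute [symmetric] mult.commute)
  then show ?thesis
    by (intro eq_matI) (simp_all add: gram_ip scalar_prod_def atLeast0LessThan)
qed

lemma gram_parseval2:
  assumes "onb S1 S b k" "onb S0 S1 c l" "S0 \<subseteq> S1" "S1 \<subseteq> grid N M"
    "\<And>i. i < d \<Longrightarrow> Poly_Mapping.keys (f i) \<subseteq> S" "\<And>i. i < d \<Longrightarrow> orth (f i) S0"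
  shows "gram L d e f g = gram L d k f b * gram L k e b g + gram L d l f c * gram L l e c g"
proof -
  have "ip (f i) (g j) = (\<Sum>r<k. ip (f i) (b r) * ip (b r) (g j)) + (\<Sum>r<l. ip (f i) (c r) * ip (c r) (g j))"
    if "i < d" for i j
    using assms(1,2) assms(5) [OF that] assms(6) [OF that] assms(3,4) by (rule onb_parseval2)
  then show ?thesis
    by (intro eq_matI) (simp_all add: gram_ip scalar_prod_def atLeast0LessThan)
qed

lemma gram_parseval2_right:
  assumes "onb S1 S b k" "onb S0 S1 c l" "S0 \<subseteq> S1" "S1 \<subseteq> grid N M"
    "\<And>i. i < d \<Longrightarrow> Poly_Mapping.keys (f i) \<subseteq> S" "\<And>i. i < d \<Longrightarrow> orth (f i) S0"
  shows "gram L e d g f = gram L e k g b * gram L k d b f + gram L e l g c * gram L l d c f"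
proof -
  have "ip (g j) (f i) = (\<Sum>r<k. ip (g j) (b r) * ip (b r) (f i)) + (\<Sum>r<l. ip (g j) (c r) * ip (c r) (f i))"
    if "i < d" for i j
    using onb_parseval2 [OF assms(1,2) assms(5) [OF that] assms(6) [OF that] assms(3,4), of "g j",
        THEN arg_cong [where f = cnj]]
    by (simp add: ip_commute [symmetric] mult.commute)
  then show ?thesis
    by (intro eq_matI) (simp_all add: gram_ip scalar_prod_def atLeast0LessThan)
qed

lemma ip_shift: "ip (lmono a b * p) q = ip p (lmono (- a) (- b) * q)"
  using ip_lmono_mult [of a b p "lmono (- a) (- b) * q"] by (simp add: mult.assoc [symmetric] lmono_mult)

lemma orth_shift:
  assumes "orth p S" "\<And>i j. (i, j) \<in> T \<Longrightarrow> (i - a, j - b) \<in> S"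
  shows "orth (lmono a b * p) T"
proof -
  have "ip (lmono a b * p) (lmono i j) = ip p (lmono (i - a) (j - b))" for i j
    by (simp add: ip_shift lmono_mult)
  then show ?thesis
    using assms unfolding orth_iff by fastforce
qed

section \<open>Invertibility of \<open>tA\<close> and symmetry of \<open>hat_tE\<close>\<close>

text \<open>Multiplied by \<open>w\<close>, the lower \<open>tphi\<close> of index \<open>l\<close>
  has leading exponent \<open>(l, m)\<close>. So it is orthogonal to each \<open>tphi L n m\<close>
  of larger index, and pairing it with index \<open>l\<close> gives a quotient of nonzero leading
  coefficients. Indices decrease along rows and columns, so the zeros lie below the
  diagonal.\<close>

lemma tA_upper_triangular:
  assumes "0 \<le> n" "n \<le> N" "0 < m" "m \<le> M"
  shows "i < nat (n + 1) \<Longrightarrow> j < i \<Longrightarrow> tA L n m $$ (i, j) = 0"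
    and "i < nat (n + 1) \<Longrightarrow> tA L n m $$ (i, i) \<noteq> 0"
proof -
  define S where "S = (\<lambda>(m::int) (l::int). {(i, j). 0 \<le> i \<and> i \<le> n \<and> 0 \<le> j \<and> j < m} \<union> {(i, m) | i. 0 \<le> i \<and> i \<le> l})"
  have tphi: "tphi L n m l = orthopoly L (S m l) (l, m)" for l m
    by (simp add: tphi_def S_def)
  have S: "S k l \<subseteq> grid N M" "(l, k) \<in> S k l" if "0 \<le> l" "l \<le> n" "0 \<le> k" "k \<le> M" for k l
    using that assms by (auto simp: S_def)
  note o = orthopoly [OF S, folded tphi]
  define p where "p = (\<lambda>l. lmono 0 1 * tphi L n (m - 1) l)"
  have p: "Poly_Mapping.keys (p l) \<subseteq> S m l" "Poly_Mapping.lookup (p l) (l, m) \<noteq> 0" if "0 \<le> l" "l \<le> n" for l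
  proof -
    have *: "Poly_Mapping.keys (tphi L n (m - 1) l) \<subseteq> S (m - 1) l"
      using that assms by (intro o) auto
    show "Poly_Mapping.keys (p l) \<subseteq> S m l"
    proof (clarsimp simp: p_def in_keys_iff)
      fix i j assume "Poly_Mapping.lookup (tphi L n (m - 1) l) (i, j - 1) \<noteq> 0"
      then have "(i, j - 1) \<in> S (m - 1) l"
        using * by (auto simp: in_keys_iff)
      then show "(i, j) \<in> S m l"
        using that by (auto simp: S_def)
    qed
    show "Poly_Mapping.lookup (p l) (l, m) \<noteq> 0"
      using o(2) [of l "m - 1"] that assms by (auto simp: p_def)
  qed
  have "ip (p l) (tphi L n m l') = 0" if "0 \<le> l" "l < l'" "l' \<le> n" for l l'
  proof (rule orth_commuteD)
    show "orth (tphi L n m l') (S m l' - {(l', m)})"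
      using that assms by (intro o) auto
    show "Poly_Mapping.keys (p l) \<subseteq> S m l' - {(l', m)}"
      using p(1) [of l] that by (force simp: S_def)
  qed
  then show "i < nat (n + 1) \<Longrightarrow> j < i \<Longrightarrow> tA L n m $$ (i, j) = 0"
    by (simp add: tA_gram gram_ip p_def)
  have "ip (p l) (tphi L n m l) \<noteq> 0" if "0 \<le> l" "l \<le> n" for l
    using that assms p [OF that] by (simp add: tphi ip_orthopoly S) (use o(2) [of l m] in \<open>auto simp: tphi\<close>)
  then show "i < nat (n + 1) \<Longrightarrow> tA L n m $$ (i, i) \<noteq> 0"
    by (simp add: tA_gram gram_ip p_def)
qed

text \<open>The triangular shape leaves the product of the diagonal entries. This makes
  \<open>minv\<close> meaningful in the theorem.\<close>

lemma det_cnj_tA: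
  assumes "0 \<le> n" "n \<le> N" "0 < m" "m \<le> M"
  shows "det (map_mat cnj (tA L n m)) \<noteq> 0"
proof -
  have "tA L n m \<in> carrier_mat (nat (n + 1)) (nat (n + 1))"
    by (simp add: tA_gram)
  then have "det (map_mat cnj (tA L n m)) = prod_list (diag_mat (map_mat cnj (tA L n m)))"
    using tA_upper_triangular(1) [OF assms] by (intro det_upper_triangular) auto
  also have "\<dots> \<noteq> 0"
    using tA_upper_triangular(2) [OF assms] \<open>tA L n m \<in> _\<close>
    by (auto simp: prod_list_zero_iff diag_mat_def)
  finally show ?thesis .
qed

text \<open>The \<open>ldagger\<close> of a reversal is the polynomial times a monomial, so each
  entry is the functional at \<open>p * q\<close> times a fixed monomial, symmetric in
  \<open>p\<close> and \<open>q\<close>.\<close>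

lemma hat_tE_symmetric: "transpose_mat (hat_tE L n m) = hat_tE L n m"
proof -
  have "lmono 0 (- 1) * reversal n (m - 1) p = reversal n (m - 1) (lmono 0 1 * p)" for p
    by (simp add: reversal_def ldagger_mult ldagger_lmono mult.left_commute)
  then have "ip (lmono 0 1 * p) (reversal n (m - 1) q) = ip (lmono 0 1 * q) (reversal n (m - 1) p)" for p q
    by (metis ip_shift ip_reversal_right minus_zero)
  then show ?thesis
    by (intro eq_matI) (simp_all add: hat_tE_gram gram_ip)
qed

text \<open>Expand the entries of \<open>w \<Phi>~\<^bsub>n,m-1\<^esub>\<close> in \<open>\<Phi>~\<^bsub>n,m\<^esub>\<close> and the reversal of \<open>\<Phi>~\<^bsub>n,m-1\<^esub>\<close>, and pair with
  the reversal of \<open>\<Phi>~\<^bsub>n,m\<^esub>\<close>: the left side vanishes, because reversing both arguments turns it into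
  a pairing of \<open>\<Phi>~\<^bsub>n,m\<^esub>\<close> with elements of \<open>V\<^bsub>n,m-1\<^esub>\<close>.\<close>

lemma reversal_tphi_gram:
  assumes "0 \<le> n" "n \<le> N" "0 < m" "m \<le> M"
  defines "T \<equiv> \<lambda>r. tphi L n m (n - int r)"
  shows "map_mat cnj (tA L n m) * gram L (nat (n + 1)) (nat (n + 1)) (\<lambda>r. reversal n m (T r)) T
    + mat_adjoint (hat_tE L n m) * tA L n m = 0\<^sub>m (nat (n + 1)) (nat (n + 1))"
proof -
  define d where "d = nat (n + 1)"
  define U where "U = (\<lambda>r. tphi L n (m - 1) (n - int r))"
  define w where "w = (\<lambda>p. lmono 0 1 * p)"
  have T: "onb (grid n (m - 1)) (grid n m) T d"
    unfolding T_def d_def using assms(1-4) by (intro onb_tphi) auto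
  have U: "onb (grid n (m - 1 - 1)) (grid n (m - 1)) U d"
    unfolding U_def d_def using assms(1-4) by (intro onb_tphi) auto
  have RU: "onb ({0..n} \<times> {1..m - 1}) (grid n (m - 1)) (\<lambda>r. reversal n (m - 1) (U r)) d"
    unfolding U_def d_def using assms(1-4) by (intro onb_reversal_tphi) auto
  have keys_wU: "Poly_Mapping.keys (w (U i)) \<subseteq> grid n m" if "i < d" for i
    unfolding w_def using onb_keys [OF U that] by (rule keys_lmono_mult) auto
  have orth_wU: "orth (w (U i)) ({0..n} \<times> {1..m - 1})" if "i < d" for i
    unfolding w_def using onb_orth [OF U that] by (rule orth_shift) auto
  have rev_w: "reversal n m (w p) = reversal n (m - 1) p" for p
    by (simp add: w_def reversal_lmono_mult)
  have rev_w': "reversal n m (reversal n (m - 1) p) = w p" for p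
    by (simp add: rev_w [symmetric])
  \<comment> \<open>Parseval produces the entrywise conjugate of \<open>hat_tE\<close>; symmetry
    turns it into the adjoint.\<close>
  have E: "ip (w (U j)) (reversal n (m - 1) (U i)) = ip (w (U i)) (reversal n (m - 1) (U j))"
    if "i < d" "j < d" for i j
    using arg_cong [OF hat_tE_symmetric [of n m], of "\<lambda>A. A $$ (i, j)"] that
    by (simp add: hat_tE_gram gram_ip d_def U_def w_def)
  have eq0: "(\<Sum>r<d. cnj (ip (w (U i)) (T r)) * ip (reversal n m (T r)) (T k))
      + (\<Sum>r<d. cnj (ip (w (U r)) (reversal n (m - 1) (U i))) * ip (w (U r)) (T k)) = 0"
    if "i < d" "k < d" for i k
  proof -
    have sub: "{0..n} \<times> {1..m - 1} \<subseteq> grid n (m - 1)" "grid n (m - 1) \<subseteq> grid N M"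
      using assms(1-4) by auto
    have 1: "cnj (ip (T r) (reversal n m (T k))) = ip (reversal n m (T r)) (T k)" for r
      by (simp add: ip_commute [symmetric] ip_reversal_left [of n m "T r"])
    have 2: "cnj (ip (reversal n (m - 1) (U r)) (reversal n m (T k))) = ip (w (U r)) (T k)" for r
      by (simp add: ip_reversal_right [of "reversal n (m - 1) (U r)"] rev_w' ip_commute [symmetric])
    have "ip (w (U i)) (reversal n m (T k)) = ip (T k) (reversal n (m - 1) (U i))"
      by (simp add: ip_reversal_right [of "w (U i)"] rev_w)
    also have "\<dots> = 0"
      using onb_orth [OF T] onb_keys [OF RU] that by (auto intro: orthD)
    finally have "0 = cnj (ip (w (U i)) (reversal n m (T k)))"
      by simp
    \<comment> \<open>The chain runs from \<open>grid n m\<close> through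
      \<open>grid n (m - 1)\<close> to the rows \<open>1..m - 1\<close>, to which
      \<open>w (U i)\<close> is orthogonal.\<close>
    also have "\<dots> = (\<Sum>r<d. cnj (ip (w (U i)) (T r)) * cnj (ip (T r) (reversal n m (T k))))
      + (\<Sum>r<d. cnj (ip (w (U i)) (reversal n (m - 1) (U r)))
          * cnj (ip (reversal n (m - 1) (U r)) (reversal n m (T k))))"
      by (subst onb_parseval2 [OF T RU keys_wU [OF that(1)] orth_wU [OF that(1)] sub]) simp
    finally show ?thesis
      using E [OF that(1)] by (simp add: 1 2)
  qed
  show ?thesis
    by (intro eq_matI)
      (simp_all add: tA_gram hat_tE_gram mat_adjoint_index gram_ip d_def [symmetric] T_def [symmetric]
        w_def [symmetric] scalar_prod_def atLeast0LessThan eq0 [unfolded U_def])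
qed

section \<open>The relation for a functional on all Laurent polynomials\<close>

lemma Gam1_relation:
  assumes "0 < n" "n \<le> N" "0 < m" "m \<le> M"
  shows "Gam1 L n m * mat_adjoint (Gam L n m) =
    I0 L n (m - 1) * hat_tE L n m * transpose_mat (I1 L n (m - 1))
    + mat_adjoint (Gam L n (m - 1)) * Gam1 L n (m - 1)
    + K1 L n m * minv (map_mat cnj (tA L (n - 1) m)) * mat_adjoint (hat_tE L (n - 1) m)
        * tA L (n - 1) m * mat_adjoint (K L n m)"
proof -
  define d where "d = nat m"
  define X where "X = (\<lambda>r. phi L n (m - 1) (m - 1 - int r))"
  define Y where "Y = (\<lambda>r. phi L n m (m - int r))"
  define Z where "Z = (\<lambda>r. phi L n (m - 1 - 1) (m - 1 - 1 - int r))"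
  define U where "U = (\<lambda>r. tphi L n (m - 1) (n - int r))"
  define T where "T = (\<lambda>r. tphi L (n - 1) m (n - 1 - int r))"
  define w where "w = (\<lambda>f r::nat. lmono 0 1 * f r)"
  define R where "R = (\<lambda>n m f r::nat. reversal n m (f r))"
  define W where "W = gram L d d (w X) X"
  define Q where "Q = gram L (nat n) (nat n) (R (n - 1) m T) T"
  define A where "A = map_mat cnj (tA L (n - 1) m)"
  note defs = X_def Y_def Z_def U_def T_def w_def R_def
  have dims: "nat (m - 1 + 1) = d" "nat (n - 1 + 1) = nat n"
    by (simp_all add: d_def)
  have X: "onb (grid (n - 1) (m - 1)) (grid n (m - 1)) X d"
    unfolding X_def dims(1) [symmetric] using assms by (intro onb_phi) auto
  have Y: "onb (grid (n - 1) m) (grid n m) Y (nat (m + 1))"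
    unfolding Y_def using assms by (intro onb_phi) auto
  \<comment> \<open>Degree -1 in \<open>w\<close> occurs here, namely for \<open>m = 1\<close>; then
    \<open>Z\<close> has length 0.\<close>
  have Z: "onb (grid (n - 1) (m - 1 - 1)) (grid n (m - 1 - 1)) Z (nat (m - 1))"
    unfolding Z_def using onb_phi [of n "m - 1 - 1"] assms by simp
  have U: "onb (grid n (m - 1 - 1)) (grid n (m - 1)) U (nat (n + 1))"
    unfolding U_def using assms by (intro onb_tphi) auto
  have T: "onb (grid (n - 1) (m - 1)) (grid (n - 1) m) T (nat n)"
    unfolding T_def dims(2) [symmetric] using assms by (intro onb_tphi) auto
  have RU: "onb ({0..n} \<times> {1..m - 1}) (grid n (m - 1)) (R n (m - 1) U) (nat (n + 1))"
    unfolding R_def U_def using assms by (intro onb_reversal_tphi) auto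
  have RT: "onb ({0..n - 1} \<times> {1..m}) (grid (n - 1) m) (R (n - 1) m T) (nat n)"
    unfolding R_def T_def dims(2) [symmetric] using assms by (intro onb_reversal_tphi) auto

  have "W = Gam1 L n m * mat_adjoint (Gam L n m) + gram L d (nat n) (w X) T * mat_adjoint (K L n m)"
  proof -
    have "Poly_Mapping.keys (X i) \<subseteq> grid n m" if "i < d" for i
      using onb_keys [OF X that] by auto
    then have "W = gram L d (nat (m + 1)) (w X) Y * gram L (nat (m + 1)) d Y X
        + gram L d (nat n) (w X) T * gram L (nat n) d T X"
      unfolding W_def using assms onb_orth [OF X] by (intro gram_parseval2_right [OF Y T]) auto
    then show ?thesis
      by (simp add: coefficient_gram mat_adjoint_gram dims d_def [symmetric] defs)
  qed
  moreover have "gram L d (nat n) (w X) T = K1 L n m * Q"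
  proof -
    \<comment> \<open>Shifting \<open>grid (n - 1) (m - 1)\<close> by \<open>w\<close> yields
      exactly the span that the reversal of \<open>T\<close> complements in
      \<open>grid (n - 1) m\<close>.\<close>
    have "orth (w X i) ({0..n - 1} \<times> {1..m})" if "i < d" for i
      unfolding w_def using onb_orth [OF X that] by (rule orth_shift) auto
    then have "gram L d (nat n) (w X) T = gram L d (nat n) (w X) (R (n - 1) m T) * Q"
      unfolding Q_def using onb_keys [OF T] by (intro gram_parseval [OF RT]) auto
    then show ?thesis
      by (simp add: coefficient_gram d_def [symmetric] defs)
  qed
  moreover have "W = I0 L n (m - 1) * gram L (nat (n + 1)) d (w U) X
      + mat_adjoint (Gam L n (m - 1)) * Gam1 L n (m - 1)"
  proof -
    \<comment> \<open>The factor \<open>w\<close> moves to the right argument so that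
      \<open>X\<close> itself is expanded, and returns onto the basis vectors afterwards.\<close>
    have shift: "gram L k e (w f) g = gram L k e f (\<lambda>r. lmono 0 (- 1) * g r)" for k e f g
      using ip_shift [of 0 1] by (simp add: gram_ip w_def)
    have "orth (X i) (grid (n - 1) (m - 1 - 1))" if "i < d" for i
      using onb_orth [OF X that] by (rule orth_mono) auto
    then have "W = gram L d (nat (n + 1)) X U * gram L (nat (n + 1)) d (w U) X
        + gram L d (nat (m - 1)) X Z * gram L (nat (m - 1)) d (w Z) X"
      unfolding W_def shift using assms onb_keys [OF X] by (intro gram_parseval2 [OF U Z]) auto
    then show ?thesis
      by (simp add: coefficient_gram mat_adjoint_gram d_def [symmetric] defs)
  qed
  moreover have "gram L (nat (n + 1)) d (w U) X = hat_tE L n m * transpose_mat (I1 L n (m - 1))"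
  proof -
    have "orth (w U i) ({0..n} \<times> {1..m - 1})" if "i < nat (n + 1)" for i
      unfolding w_def using onb_orth [OF U that] by (rule orth_shift) auto
    then have "gram L (nat (n + 1)) d (w U) X
        = gram L (nat (n + 1)) (nat (n + 1)) (w U) (R n (m - 1) U)
          * gram L (nat (n + 1)) d (R n (m - 1) U) X"
      using onb_keys [OF X] by (intro gram_parseval [OF RU]) auto
    \<comment> \<open>Reversal exchanges the roles of \<open>U\<close> and \<open>X\<close> without
      conjugation, hence the plain transpose of \<open>I1\<close>.\<close>
    moreover have "gram L (nat (n + 1)) d (R n (m - 1) U) X
        = transpose_mat (gram L d (nat (n + 1)) (R n (m - 1) X) U)"
      by (rule eq_matI) (simp_all add: gram_ip R_def ip_reversal_left [of n "m - 1" "U _"])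
    ultimately show ?thesis
      by (simp add: coefficient_gram d_def [symmetric] defs)
  qed
  \<comment> \<open>The two expansions of \<open>W\<close> are equated. It remains to rewrite the
    term with \<open>Q\<close>; its elimination brings the sign that moves it to the right-hand
    side.\<close>
  ultimately have *: "Gam1 L n m * mat_adjoint (Gam L n m) + K1 L n m * Q * mat_adjoint (K L n m)
      = I0 L n (m - 1) * (hat_tE L n m * transpose_mat (I1 L n (m - 1)))
        + mat_adjoint (Gam L n (m - 1)) * Gam1 L n (m - 1)"
    by simp

  have carrier: "Gam1 L n m \<in> carrier_mat d (nat (m + 1))" "mat_adjoint (Gam L n m) \<in> carrier_mat (nat (m + 1)) d"
    "I0 L n (m - 1) \<in> carrier_mat d (nat (n + 1))" "hat_tE L n m \<in> carrier_mat (nat (n + 1)) (nat (n + 1))"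
    "transpose_mat (I1 L n (m - 1)) \<in> carrier_mat (nat (n + 1)) d"
    "mat_adjoint (Gam L n (m - 1)) \<in> carrier_mat d (nat (m - 1))" "Gam1 L n (m - 1) \<in> carrier_mat (nat (m - 1)) d"
    "K1 L n m \<in> carrier_mat d (nat n)" "A \<in> carrier_mat (nat n) (nat n)"
    "mat_adjoint (hat_tE L (n - 1) m) \<in> carrier_mat (nat n) (nat n)"
    "tA L (n - 1) m \<in> carrier_mat (nat n) (nat n)" "mat_adjoint (K L n m) \<in> carrier_mat (nat n) d"
    "Q \<in> carrier_mat (nat n) (nat n)"
    by (simp_all add: coefficient_gram mat_adjoint_gram dims d_def A_def Q_def)
  have "det A \<noteq> 0"
    unfolding A_def using assms by (intro det_cnj_tA) auto
  note B = minv_left_inverse [OF carrier(9) this]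
  have "A * Q + mat_adjoint (hat_tE L (n - 1) m) * tA L (n - 1) m = 0\<^sub>m (nat n) (nat n)"
    using reversal_tphi_gram [of "n - 1" m] assms by (simp add: A_def Q_def R_def T_def)
  then have "K1 L n m * minv A * mat_adjoint (hat_tE L (n - 1) m) * tA L (n - 1) m * mat_adjoint (K L n m)
      = - (K1 L n m * Q * mat_adjoint (K L n m))"
    using carrier B by (intro mat_eliminate)
  moreover have "I0 L n (m - 1) * hat_tE L n m * transpose_mat (I1 L n (m - 1))
      = I0 L n (m - 1) * (hat_tE L n m * transpose_mat (I1 L n (m - 1)))"
    using carrier by (intro assoc_mult_mat)
  ultimately show ?thesis
    unfolding A_def [symmetric]
    using carrier by (simp only:) (intro mat_add_eqD [OF *, of d d] add_carrier_mat mult_carrier_mat)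
qed

end

section \<open>Extension of a positive definite functional\<close>

text \<open>The functional is only linear on \<^term>\<open>laurent_space N M\<close>; setting the moments outside the
  index box to zero extends it to a linear functional on all Laurent polynomials.\<close>

lemma moment_functional_extension:
  assumes "positive_definite_functional N M L"
  obtains L' where "moment_functional L' N M" "\<And>p. p \<in> laurent_space N M \<Longrightarrow> L' p = L p"
proof -
  define Box where "Box = {(i, j). \<bar>i\<bar> \<le> N \<and> \<bar>j\<bar> \<le> M}"
  define \<mu> where "\<mu> = (\<lambda>k. if k \<in> Box then L (lmono (fst k) (snd k)) else 0)"
  define L' where "L' = (\<lambda>p. \<Sum>k\<in>Poly_Mapping.keys p. Poly_Mapping.lookup p k * \<mu> k)"
  have lin: "linear_functional_on (laurent_space N M) L"
    and herm: "\<And>i j. \<bar>i\<bar> \<le> N \<Longrightarrow> \<bar>j\<bar> \<le> M \<Longrightarrow> L (lmono (- i) (- j)) = cnj (L (lmono i j))"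
    and pos: "\<And>p. p \<in> poly_space N M \<Longrightarrow> p \<noteq> 0 \<Longrightarrow> 0 < L (p * ldagger p)"
    using assms by (auto simp: positive_definite_functional_def hermitian_functional_def)
  have space: "p \<in> laurent_space N M \<longleftrightarrow> Poly_Mapping.keys p \<subseteq> Box" for p
    by (simp add: laurent_space_def mem_lspan_iff Box_def)
  \<comment> \<open>Summing over any finite set containing the support lets \<open>p\<close>,
    \<open>q\<close> and \<open>p + q\<close> share one index set.\<close>
  have L'_sum: "L' p = (\<Sum>k\<in>F. Poly_Mapping.lookup p k * \<mu> k)"
    if "finite F" "Poly_Mapping.keys p \<subseteq> F" for p F
    unfolding L'_def using that by (intro sum.mono_neutral_left) (auto simp: in_keys_iff)
  have agree: "L' p = L p" if "p \<in> laurent_space N M" for p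
  proof -
    define t where "t = (\<lambda>k. lscale (Poly_Mapping.lookup p k) (lmono (fst k) (snd k)))"
    have t: "Poly_Mapping.keys (t k) \<subseteq> {k}" for k
      unfolding t_def by (intro keys_lscale_subset) simp
    have t_Box: "t k \<in> laurent_space N M" if "k \<in> Box" for k
      using t [of k] that unfolding space by blast
    have L_add: "L (q + r) = L q + L r" and L_scale: "L (lscale c q) = c * L q"
      if "q \<in> laurent_space N M" "r \<in> laurent_space N M" for q r c
      using lin that unfolding linear_functional_on_def by blast+
    have "L (\<Sum>k\<in>F. t k) = (\<Sum>k\<in>F. Poly_Mapping.lookup p k * \<mu> k)"
      if "finite F" "F \<subseteq> Box" for F
      using that
    proof (induction F rule: finite_induct)
      case empty
      show ?case
        using L_add [of 0 0] by (simp add: space)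
    next
      case (insert k F)
      have "(\<Sum>k\<in>F. t k) \<in> laurent_space N M"
        unfolding space using insert.prems t_Box [unfolded space] by (intro keys_sum_subset) auto
      \<comment> \<open>\<open>L_scale\<close> is stated together with \<open>L_add\<close> and so
        inherits a condition on \<open>r\<close>, which 0 meets.\<close>
      moreover have "L (t k) = Poly_Mapping.lookup p k * \<mu> k"
        unfolding t_def using insert.prems by (subst L_scale [where r = 0]) (auto simp: \<mu>_def space)
      ultimately show ?case
        using insert t_Box by (simp add: L_add)
    qed
    moreover have "p = (\<Sum>k\<in>Poly_Mapping.keys p. t k)"
      using laurent_expansion [of "Poly_Mapping.keys p" p] by (simp add: t_def case_prod_unfold)
    ultimately show ?thesis
      using that by (metis L'_def finite_keys space)
  qed
  have "moment_functional L' N M"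
  proof
    fix p q :: laurent
    let ?F = "Poly_Mapping.keys p \<union> Poly_Mapping.keys q"
    have "L' (p + q) = (\<Sum>k\<in>?F. Poly_Mapping.lookup (p + q) k * \<mu> k)"
      by (intro L'_sum) (simp_all add: keys_add)
    also have "\<dots> = L' p + L' q"
      by (simp add: L'_sum [of ?F] lookup_add distrib_right sum.distrib)
    finally show "L' (p + q) = L' p + L' q" .
  next
    fix c and p :: laurent
    show "L' (lscale c p) = c * L' p"
      by (subst L'_sum [of "Poly_Mapping.keys p"])
        (simp_all add: keys_lscale_subset L'_def sum_distrib_left mult.assoc)
  next
    fix p :: laurent
    \<comment> \<open>The box is symmetric under negation, so the moments set to zero respect the
      hermitian symmetry too.\<close>
    have \<mu>: "\<mu> (- k) = cnj (\<mu> k)" for k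
      using herm by (cases k) (auto simp: \<mu>_def Box_def)
    have "Poly_Mapping.keys (ldagger p) \<subseteq> uminus ` Poly_Mapping.keys p"
      by (force simp: in_keys_iff lookup_ldagger_uminus intro: image_eqI [of _ _ "- _"])
    then have "L' (ldagger p) = (\<Sum>k\<in>uminus ` Poly_Mapping.keys p. Poly_Mapping.lookup (ldagger p) k * \<mu> k)"
      by (intro L'_sum) auto
    also have "\<dots> = cnj (L' p)"
      by (subst sum.reindex) (simp_all add: lookup_ldagger_uminus \<mu> L'_def)
    finally show "L' (ldagger p) = cnj (L' p)" .
  next
    fix p :: laurent
    assume p: "Poly_Mapping.keys p \<subseteq> grid N M" "p \<noteq> 0"
    then have "p \<in> poly_space N M"
      by (auto simp: poly_space_def mem_lspan_iff)
    then show "0 < L' (p * ldagger p)"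
      using pos p keys_mult_ldagger by (simp add: agree)
  qed
  then show thesis
    using agree by (rule that)
qed

section \<open>Transfer to the given functional\<close>

text \<open>For \<open>p\<close> supported in \<open>S\<close>, the defining conditions evaluate the
  functional only inside \<open>laurent_space N M\<close>, so both definite descriptions use the
  same predicate.\<close>

lemma orthopoly_cong:
  assumes "\<And>p. p \<in> laurent_space N M \<Longrightarrow> L' p = L p" "S \<subseteq> grid N M"
  shows "orthopoly L S k = orthopoly L' S k"
proof -
  have "L' (p * ldagger q) = L (p * ldagger q)"
    if "Poly_Mapping.keys p \<subseteq> S" "Poly_Mapping.keys q \<subseteq> S" for p q
    using that assms(2) by (intro assms(1) keys_mult_ldagger) auto
  then have "(p \<in> lspan S \<and> 0 < Poly_Mapping.lookup p k \<and>
     L (p * ldagger p) = 1 \<and> (\<forall>(i, j)\<in>S - {k}. L (p * ldagger (lmono i j)) = 0)) \<longleftrightarrow>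
    (p \<in> lspan S \<and> 0 < Poly_Mapping.lookup p k \<and>
     L' (p * ldagger p) = 1 \<and> (\<forall>(i, j)\<in>S - {k}. L' (p * ldagger (lmono i j)) = 0))" for p
    by (cases "Poly_Mapping.keys p \<subseteq> S") (auto simp: mem_lspan_iff Ball_def)
  then show ?thesis
    by (simp add: orthopoly_def)
qed

lemma gram_cong:
  assumes "\<And>p. p \<in> laurent_space N M \<Longrightarrow> L' p = L p"
    and "\<And>i. i < d \<Longrightarrow> f i = f' i" "\<And>i. i < e \<Longrightarrow> g i = g' i"
    and "\<And>i. i < d \<Longrightarrow> Poly_Mapping.keys (f' i) \<subseteq> grid N M"
    and "\<And>i. i < e \<Longrightarrow> Poly_Mapping.keys (g' i) \<subseteq> grid N M"
  shows "gram L d e f g = gram L' d e f' g'"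
  using assms(2-) by (intro eq_matI) (simp_all add: gram_def assms(1) [OF keys_mult_ldagger])

theorem lemma3p14:
  fixes L :: "laurent \<Rightarrow> complex" and N M n m :: int
  assumes "positive_definite_functional N M L"
    and "0 < n" and "n \<le> N" and "0 < m" and "m \<le> M"
  shows "Gam1 L n m * mat_adjoint (Gam L n m) =
    I0 L n (m - 1) * hat_tE L n m * transpose_mat (I1 L n (m - 1))
    + mat_adjoint (Gam L n (m - 1)) * Gam1 L n (m - 1)
    + K1 L n m * minv (map_mat cnj (tA L (n - 1) m)) * mat_adjoint (hat_tE L (n - 1) m)
        * tA L (n - 1) m * mat_adjoint (K L n m)"
proof -
  obtain L' where L': "moment_functional L' N M" "\<And>p. p \<in> laurent_space N M \<Longrightarrow> L' p = L p"
    using moment_functional_extension [OF assms(1)] by blast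
  interpret moment_functional L' N M by (rule L'(1))
  have sub: "grid k l \<subseteq> grid N M" if "k \<le> N" "l \<le> M" for k l
    using that by auto
  \<comment> \<open>Multiplication by \<open>w\<close> raises the degree in \<open>w\<close> by one,
    hence the condition \<open>l < M\<close>.\<close>
  have grid: "Poly_Mapping.keys p \<subseteq> grid N M" "Poly_Mapping.keys (reversal k l p) \<subseteq> grid N M"
    "l < M \<Longrightarrow> Poly_Mapping.keys (lmono 0 1 * p) \<subseteq> grid N M"
    if "Poly_Mapping.keys p \<subseteq> grid k l" "k \<le> N" "l \<le> M" for p k l
  proof -
    show "Poly_Mapping.keys p \<subseteq> grid N M"
      using that(1) sub [OF that(2,3)] by (rule subset_trans)
    have "(\<lambda>(i, j). (k - i, l - j)) ` grid k l \<subseteq> grid k l"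
      by auto
    then show "Poly_Mapping.keys (reversal k l p) \<subseteq> grid N M"
      using keys_reversal [OF that(1), of k l] sub [OF that(2,3)] by (meson subset_trans)
    show "Poly_Mapping.keys (lmono 0 1 * p) \<subseteq> grid N M" if "l < M"
      using \<open>Poly_Mapping.keys p \<subseteq> grid k l\<close> by (rule keys_lmono_mult) (use \<open>k \<le> N\<close> that in auto)
  qed
  have phi_keys: "Poly_Mapping.keys (phi L' n k (k - int i)) \<subseteq> grid n k"
    if "i < nat (k + 1)" "k \<le> M" for i k
    using onb_keys [OF onb_phi [of n k]] that assms by simp
  have tphi_keys: "Poly_Mapping.keys (tphi L' k l (k - int i)) \<subseteq> grid k l"
    if "i < nat (k + 1)" "k \<le> N" "0 \<le> l" "l \<le> M" for i k l
    using onb_keys [OF onb_tphi [of k l]] that assms by simp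
  have phi: "phi L n k (k - int i) = phi L' n k (k - int i)" if "i < nat (k + 1)" "k \<le> M" for i k
    unfolding phi_def using that assms by (intro orthopoly_cong [OF L'(2)]) auto
  have tphi: "tphi L k l (k - int i) = tphi L' k l (k - int i)"
    if "i < nat (k + 1)" "k \<le> N" "0 \<le> l" "l \<le> M" for i k l
    unfolding tphi_def using that assms by (intro orthopoly_cong [OF L'(2)]) auto
  \<comment> \<open>All polynomials involved are supported in \<open>grid N M\<close>, where both
    functionals give the same inner products.\<close>
  have eqs: "Gam1 L n m = Gam1 L' n m" "Gam L n m = Gam L' n m"
    "I0 L n (m - 1) = I0 L' n (m - 1)" "I1 L n (m - 1) = I1 L' n (m - 1)"
    "hat_tE L n m = hat_tE L' n m" "hat_tE L (n - 1) m = hat_tE L' (n - 1) m"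
    "tA L (n - 1) m = tA L' (n - 1) m" "K L n m = K L' n m" "K1 L n m = K1 L' n m"
    "Gam L n (m - 1) = Gam L' n (m - 1)" "Gam1 L n (m - 1) = Gam1 L' n (m - 1)"
    unfolding coefficient_gram
    by (rule gram_cong [of N M L' L]; insert assms(2-5);
      simp add: L'(2) phi tphi grid [OF phi_keys] grid [OF tphi_keys])+
  show ?thesis
    unfolding eqs using assms(2-5) by (rule Gam1_relation)
qed

end
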